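(* Let $G$ be a finite nilpotent group of step $L\ge2$. Let $S\subseteq G$ be a symmetric set of generators of $G$ and let $R\subseteq S$ be such that $|\{s,s^{-1}\}\cap R|=1$ for all $s\in S$. Then $$\mathrm{Diam}_S(G_2)\le\sum_{i=2}^{L}\mathrm{Diam}_S(G_i/G_{i+1})\le\sum_{i=2}^{L}2^{5i+7}|R|^i\left(2^{2i}+L\cdot\left\lceil \mathrm{Diam}_S(G_{\mathrm{ab}})/|R|\right\rceil^{1/i}\right).$$
   Context: Lower central series: $G_1=G$, $G_{i+1}=[G_i,G]$; the step $L$ satisfies $|G_L|>1=|G_{L+1}|$; $G_{\mathrm{ab}}=G/G_2$. A set $S$ is symmetric if $s\in S\iff s^{-1}\in S$. For a subgroup $H\le G$, $\mathrm{Diam}_S(H):=\max\{\mathrm{dist}_S(\mathrm{id},h):h\in H\}$, where $\mathrm{dist}_S$ is graph distance in $\mathrm{Cay}(G,S)$ (edges $\{g,gs\}$, $s\in S$). For $H\trianglelefteq H'\trianglelefteq G$ with $H\trianglelefteq G$, put $S_H:=\{Hs:s\in S\}$ and $\mathrm{Diam}_S(H'/H):=\max\{\mathrm{dist}_{S_H}(H,Hh'):h'\in H'\}$, where $\mathrm{dist}_{S_H}$ is graph distance in $\mathrm{Cay}(G/H,S_H)$. In particular $\mathrm{Diam}_S(G_{\mathrm{ab}})$ is the diameter of $\mathrm{Cay}(G/G_2,S_{G_2})$. *)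

theory Defs
  imports Complex_Main "HOL-Algebra.Algebra"
begin

definition commutator_subgroup :: "('a, 'b) monoid_scheme \<Rightarrow> 'a set \<Rightarrow> 'a set \<Rightarrow> 'a set" where
  "commutator_subgroup G H K =
     generate G (\<Union>h \<in> H. \<Union>k \<in> K. {h \<otimes>\<^bsub>G\<^esub> k \<otimes>\<^bsub>G\<^esub> inv\<^bsub>G\<^esub> h \<otimes>\<^bsub>G\<^esub> inv\<^bsub>G\<^esub> k})"

text \<open>The series is indexed from 1; the value at index 0 is a dummy.\<close>

fun lower_central :: "('a, 'b) monoid_scheme \<Rightarrow> nat \<Rightarrow> 'a set" where
  "lower_central G 0 = carrier G"
| "lower_central G (Suc 0) = carrier G"
| "lower_central G (Suc (Suc n)) =
     commutator_subgroup G (lower_central G (Suc n)) (carrier G)"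

text \<open>In a finite group the condition on cardinalities entails nilpotency, since it says that
  the series reaches the trivial subgroup at index \<open>L + 1\<close>.\<close>

definition finite_nilpotent_of_step :: "('a, 'b) monoid_scheme \<Rightarrow> nat \<Rightarrow> bool" where
  "finite_nilpotent_of_step G L \<longleftrightarrow>
     group G \<and> finite (carrier G) \<and>
     card (lower_central G L) > 1 \<and> card (lower_central G (Suc L)) = 1"

definition symmetric_subset :: "('a, 'b) monoid_scheme \<Rightarrow> 'a set \<Rightarrow> bool" where
  "symmetric_subset G S \<longleftrightarrow>
     S \<subseteq> carrier G \<and> (\<forall>s \<in> carrier G. s \<in> S \<longleftrightarrow> inv\<^bsub>G\<^esub> s \<in> S)"

text \<open>Edges \<open>{g, g s}\<close> are undirected, so the adjacency relation contains both orientations.\<close>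

definition cayley_adj :: "('a, 'b) monoid_scheme \<Rightarrow> 'a set \<Rightarrow> 'a rel" where
  "cayley_adj G S =
     (let E = {(g, g \<otimes>\<^bsub>G\<^esub> s) | g s. g \<in> carrier G \<and> s \<in> S} in E \<union> E\<inverse>)"

text \<open>Length of a shortest walk. It is meaningful only for vertices in the same component, as is
  always the case when \<open>S\<close> generates \<open>G\<close>.\<close>

definition cayley_dist :: "('a, 'b) monoid_scheme \<Rightarrow> 'a set \<Rightarrow> 'a \<Rightarrow> 'a \<Rightarrow> nat" where
  "cayley_dist G S x y = (LEAST n. (x, y) \<in> cayley_adj G S ^^ n)"

definition subgroup_diam :: "('a, 'b) monoid_scheme \<Rightarrow> 'a set \<Rightarrow> 'a set \<Rightarrow> nat" where
  "subgroup_diam G S H = Max {cayley_dist G S \<one>\<^bsub>G\<^esub> h | h. h \<in> H}"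

definition coset_image :: "('a, 'b) monoid_scheme \<Rightarrow> 'a set \<Rightarrow> 'a set \<Rightarrow> 'a set set" where
  "coset_image G S H = {H #>\<^bsub>G\<^esub> s | s. s \<in> S}"

text \<open>\<open>quotient_diam G S H' H\<close> is the diameter of \<open>H'/H\<close>, measured in the Cayley graph of the
  whole quotient \<open>G/H\<close>; it is used for \<open>H \<subseteq> H'\<close> with \<open>H\<close> normal in \<open>G\<close>.\<close>

definition quotient_diam ::
    "('a, 'b) monoid_scheme \<Rightarrow> 'a set \<Rightarrow> 'a set \<Rightarrow> 'a set \<Rightarrow> nat" where
  "quotient_diam G S H' H =
     Max {cayley_dist (G Mod H) (coset_image G S H) H (H #>\<^bsub>G\<^esub> h') | h'. h' \<in> H'}"

end

theory Submission
  imports Defs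
begin

text \<open>
  The first inequality peels off one factor \<open>G\<^sub>i/G\<^sub>i\<^sub>+\<^sub>1\<close> at a time. For the second, the left-normed
  commutator \<open>[x, y\<^sub>1, \<dots>, y\<^sub>n]\<close> is, modulo \<open>G\<^sub>i\<^sub>+\<^sub>1\<close> with \<open>i = n + 1\<close>, multiplicative in each entry and
  depends on \<open>x\<close> only modulo \<open>G\<^sub>2\<close>. Every element of \<open>G\<^sub>i/G\<^sub>i\<^sub>+\<^sub>1\<close> is a product of at most \<open>|S|\<^sup>n\<close> such
  commutators with \<open>x\<close> arbitrary and \<open>y\<^sub>1, \<dots>, y\<^sub>n \<in> S\<close>, and \<open>x\<close> may be taken to be a word of length
  \<open>D = Diam\<^sub>S(G\<^sub>a\<^sub>b)\<close> in \<open>S\<close>. It remains to write powers of commutators of generators as short words: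
  \<open>[s, y\<^sub>1, \<dots>, y\<^sub>n]\<^sup>b\<close> with \<open>b \<le> m\<^sup>i\<close> costs \<open>O(m)\<close> letters, because \<open>m\<close>-th powers can be moved into the
  entries. With \<open>m\<close> about \<open>(D/|R|)\<^sup>1\<^sup>/\<^sup>i\<close> the word \<open>x\<close> splits into \<open>O(|R|)\<close> such powers.
\<close>

section \<open>Words, balls and iterated commutators\<close>

primrec word_prod :: "('a, 'b) monoid_scheme \<Rightarrow> 'a list \<Rightarrow> 'a" where
  "word_prod G [] = \<one>\<^bsub>G\<^esub>"
| "word_prod G (x # xs) = x \<otimes>\<^bsub>G\<^esub> word_prod G xs"

text \<open>Length at most \<open>k\<close> instead of exactly \<open>k\<close> makes the balls
  increasing in \<open>k\<close>. For a symmetric generating set this is the ball of radius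
  \<open>k\<close> about the identity in the Cayley graph, by
  \<open>cayley_dist_le_iff\<close>.\<close>

definition word_ball :: "('a, 'b) monoid_scheme \<Rightarrow> 'a set \<Rightarrow> nat \<Rightarrow> 'a set" where
  "word_ball G S k = {word_prod G ws | ws. set ws \<subseteq> S \<and> length ws \<le> k}"

text \<open>The convention is the one inside \<open>commutator_subgroup\<close>, so the generators
  of the lower central series are literally values of this function.\<close>

definition commutator :: "('a, 'b) monoid_scheme \<Rightarrow> 'a \<Rightarrow> 'a \<Rightarrow> 'a" where
  "commutator G x y = x \<otimes>\<^bsub>G\<^esub> y \<otimes>\<^bsub>G\<^esub> inv\<^bsub>G\<^esub> x \<otimes>\<^bsub>G\<^esub> inv\<^bsub>G\<^esub> y"

text \<open>The left-normed commutator \<open>[x, y\<^sub>n, \<dots>, y\<^sub>1]\<close> for the list \<open>[y\<^sub>1, \<dots>, y\<^sub>n]\<close>.\<close>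

primrec iter_commutator :: "('a, 'b) monoid_scheme \<Rightarrow> 'a \<Rightarrow> 'a list \<Rightarrow> 'a" where
  "iter_commutator G x [] = x"
| "iter_commutator G x (y # ys) = commutator G (iter_commutator G x ys) y"

section \<open>Words and Cayley distance\<close>

lemma word_ballI: "set ws \<subseteq> S \<Longrightarrow> length ws \<le> k \<Longrightarrow> word_prod G ws \<in> word_ball G S k"
  by (auto simp: word_ball_def)

lemma word_ballE:
  assumes "w \<in> word_ball G S k"
  obtains ws where "set ws \<subseteq> S" "length ws \<le> k" "w = word_prod G ws"
  using assms by (auto simp: word_ball_def)

lemma word_ball_mono: "w \<in> word_ball G S k \<Longrightarrow> k \<le> l \<Longrightarrow> w \<in> word_ball G S l"
  by (fastforce simp: word_ball_def)

context group
begin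

lemma word_prod_closed [simp]: "set ws \<subseteq> carrier G \<Longrightarrow> word_prod G ws \<in> carrier G"
  by (induction ws) auto

lemma word_prod_append:
  "set us \<subseteq> carrier G \<Longrightarrow> set vs \<subseteq> carrier G \<Longrightarrow>
    word_prod G (us @ vs) = word_prod G us \<otimes> word_prod G vs"
  by (induction us) (auto simp: m_assoc)

lemma word_prod_inv:
  "set ws \<subseteq> carrier G \<Longrightarrow> inv (word_prod G ws) = word_prod G (rev (map (m_inv G) ws))"
proof (induction ws)
  case (Cons w ws)
  then have "set (rev (map (m_inv G) ws)) \<subseteq> carrier G" by auto
  with Cons show ?case
    by (simp add: word_prod_append inv_mult_group)
qed simp

lemma one_in_word_ball: "\<one> \<in> word_ball G S k"
  using word_ballI[of "[]" S k G] by simp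

lemma generator_in_word_ball: "S \<subseteq> carrier G \<Longrightarrow> s \<in> S \<Longrightarrow> s \<in> word_ball G S 1"
  using word_ballI[of "[s]" S 1 G] by auto

lemma word_ball_closed: "S \<subseteq> carrier G \<Longrightarrow> w \<in> word_ball G S k \<Longrightarrow> w \<in> carrier G"
  by (auto elim!: word_ballE intro!: word_prod_closed)

lemma word_ball_mult:
  assumes "S \<subseteq> carrier G" "v \<in> word_ball G S k" "w \<in> word_ball G S l"
  shows "v \<otimes> w \<in> word_ball G S (k + l)"
proof -
  obtain vs where vs: "set vs \<subseteq> S" "length vs \<le> k" "v = word_prod G vs"
    using assms(2) by (rule word_ballE)
  obtain ws where ws: "set ws \<subseteq> S" "length ws \<le> l" "w = word_prod G ws"
    using assms(3) by (rule word_ballE)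
  have "v \<otimes> w = word_prod G (vs @ ws)"
    using vs ws assms(1) by (subst word_prod_append) auto
  then show ?thesis
    using vs ws by (auto intro!: word_ballI)
qed

lemma word_ball_pow:
  assumes "S \<subseteq> carrier G" "w \<in> word_ball G S k"
  shows "w [^] (n::nat) \<in> word_ball G S (n * k)"
proof (induction n)
  case (Suc n)
  then show ?case
    using word_ball_mult[OF assms(1) Suc assms(2)] by (simp add: add.commute)
qed (simp add: one_in_word_ball)

lemma word_ball_inv:
  assumes "symmetric_subset G S" "w \<in> word_ball G S k"
  shows "inv w \<in> word_ball G S k"
proof -
  have S: "S \<subseteq> carrier G" "\<And>s. s \<in> S \<Longrightarrow> inv s \<in> S"
    using assms(1) by (auto simp: symmetric_subset_def)
  obtain ws where ws: "set ws \<subseteq> S" "length ws \<le> k" "w = word_prod G ws"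
    using assms(2) by (rule word_ballE)
  have "inv w = word_prod G (rev (map (m_inv G) ws))"
    using ws S by (auto intro!: word_prod_inv)
  then show ?thesis
    using ws S by (simp only:) (rule word_ballI, auto)
qed

text \<open>The four factors have lengths \<open>k\<close>, \<open>l\<close>, \<open>k\<close>,
  \<open>l\<close>; inversion preserves word length because \<open>S\<close> is symmetric.\<close>

lemma word_ball_commutator:
  assumes sym: "symmetric_subset G S"
    and v: "v \<in> word_ball G S k" and w: "w \<in> word_ball G S l"
  shows "commutator G v w \<in> word_ball G S (2 * (k + l))"
proof -
  have S: "S \<subseteq> carrier G"
    using sym by (auto simp: symmetric_subset_def)
  have "commutator G v w \<in> word_ball G S (k + l + k + l)"
    unfolding commutator_def
    by (intro word_ball_mult S v w word_ball_inv sym)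
  then show ?thesis
    by (rule word_ball_mono) simp
qed

lemma word_ball_generate:
  assumes sym: "symmetric_subset G S" and x: "x \<in> generate G S"
  shows "\<exists>k. x \<in> word_ball G S k"
proof -
  have S: "S \<subseteq> carrier G" "\<And>s. s \<in> S \<Longrightarrow> inv s \<in> S"
    using sym by (auto simp: symmetric_subset_def)
  show ?thesis
    using x
  proof induction
    case one
    show ?case using one_in_word_ball by blast
  next
    case (incl h)
    then show ?case using generator_in_word_ball S by blast
  next
    case (inv h)
    then show ?case using generator_in_word_ball S by blast
  next
    case (eng h1 h2)
    then show ?case using word_ball_mult S by blast
  qed
qed

text \<open>An edge traversed backwards, \<open>u = v s\<close>, is the forward step
  \<open>v = u s^-1\<close>, and \<open>s^-1\<close> lies in \<open>S\<close> by symmetry. The start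
  vertex is arbitrary because the induction strips the first step of the walk.\<close>

lemma cayley_walk_iff:
  assumes sym: "symmetric_subset G S" and x: "x \<in> carrier G"
  shows "(x, y) \<in> cayley_adj G S ^^ n \<longleftrightarrow>
    (\<exists>ws. set ws \<subseteq> S \<and> length ws = n \<and> y = x \<otimes> word_prod G ws)"
proof -
  have S: "S \<subseteq> carrier G" "\<And>s. s \<in> S \<Longrightarrow> inv s \<in> S"
    using sym by (auto simp: symmetric_subset_def)
  have adj: "(u, v) \<in> cayley_adj G S \<longleftrightarrow> (\<exists>s\<in>S. v = u \<otimes> s)" if u: "u \<in> carrier G" for u v
  proof
    assume "(u, v) \<in> cayley_adj G S"
    then consider s where "s \<in> S" "v = u \<otimes> s"
      | s where "s \<in> S" "v \<in> carrier G" "u = v \<otimes> s"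
      by (auto simp: cayley_adj_def Let_def)
    then show "\<exists>s\<in>S. v = u \<otimes> s"
    proof cases
      case 2
      then have "v = u \<otimes> inv s"
        using S(1) by (auto simp: m_assoc subset_iff)
      then show ?thesis using S 2 by blast
    qed blast
  qed (use u in \<open>auto simp: cayley_adj_def Let_def\<close>)
  show ?thesis
    using x
  proof (induction n arbitrary: x)
    case (Suc n)
    have "(x, y) \<in> cayley_adj G S ^^ Suc n \<longleftrightarrow>
        (\<exists>s\<in>S. (x \<otimes> s, y) \<in> cayley_adj G S ^^ n)"
      using adj[OF Suc.prems] by (auto simp: relpow_commute simp del: relpow.simps intro: relpow_Suc_I2 elim!: relpow_Suc_E2)
    also have "\<dots> \<longleftrightarrow> (\<exists>s\<in>S. \<exists>ws. set ws \<subseteq> S \<and> length ws = n \<and> y = x \<otimes> s \<otimes> word_prod G ws)"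
      using S Suc by (intro bex_cong refl Suc.IH) auto
    also have "\<dots> \<longleftrightarrow> (\<exists>s\<in>S. \<exists>ws. set ws \<subseteq> S \<and> length ws = n \<and> y = x \<otimes> word_prod G (s # ws))"
    proof -
      have "x \<otimes> s \<otimes> word_prod G ws = x \<otimes> word_prod G (s # ws)" if "s \<in> S" "set ws \<subseteq> S" for s ws
        using that S(1) Suc.prems word_prod_closed[of ws] by (auto simp: m_assoc subset_iff)
      then show ?thesis by metis
    qed
    also have "\<dots> \<longleftrightarrow> (\<exists>ws. set ws \<subseteq> S \<and> length ws = Suc n \<and> y = x \<otimes> word_prod G ws)"
      by (auto simp: length_Suc_conv) (metis insert_subset list.simps(15) word_prod.simps(2))+
    finally show ?case .
  qed auto
qed

text \<open>Generation provides at least one walk, so the \<open>LEAST\<close> in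
  \<open>cayley_dist\<close> is attained; from here on distances can be replaced by word
  lengths.\<close>

lemma cayley_dist_le_iff:
  assumes sym: "symmetric_subset G S" and gen: "generate G S = carrier G" and y: "y \<in> carrier G"
  shows "cayley_dist G S \<one> y \<le> k \<longleftrightarrow> y \<in> word_ball G S k"
proof -
  have S: "S \<subseteq> carrier G"
    using sym by (auto simp: symmetric_subset_def)
  have walk: "(\<one>, y) \<in> cayley_adj G S ^^ n \<longleftrightarrow>
      (\<exists>ws. set ws \<subseteq> S \<and> length ws = n \<and> y = word_prod G ws)" for n
    using S word_prod_closed l_one by (subst cayley_walk_iff[OF sym]) (simp, metis subset_trans)
  obtain l where "y \<in> word_ball G S l"
    using word_ball_generate[OF sym] y gen by blast
  then have ex: "\<exists>n. (\<one>, y) \<in> cayley_adj G S ^^ n"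
    unfolding walk by (auto elim: word_ballE)
  show ?thesis
  proof
    assume le: "cayley_dist G S \<one> y \<le> k"
    have "(\<one>, y) \<in> cayley_adj G S ^^ cayley_dist G S \<one> y"
      unfolding cayley_dist_def using ex by (rule LeastI_ex)
    then show "y \<in> word_ball G S k"
      unfolding walk using le by (auto intro: word_ballI)
  next
    assume "y \<in> word_ball G S k"
    then obtain ws where ws: "set ws \<subseteq> S" "length ws \<le> k" "y = word_prod G ws"
      by (rule word_ballE)
    then have "(\<one>, y) \<in> cayley_adj G S ^^ length ws"
      unfolding walk by blast
    then have "cayley_dist G S \<one> y \<le> length ws"
      unfolding cayley_dist_def by (rule Least_le)
    with ws show "cayley_dist G S \<one> y \<le> k" by simp
  qed
qed

lemma subgroup_diam_le:
  assumes sym: "symmetric_subset G S" and gen: "generate G S = carrier G"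
    and fin: "finite (carrier G)" and H: "subgroup H G"
    and ball: "H \<subseteq> word_ball G S k"
  shows "subgroup_diam G S H \<le> k"
proof -
  have sub: "H \<subseteq> carrier G" "\<one> \<in> H"
    using H by (auto simp: subgroup.subset subgroup.one_closed)
  have fin': "finite {cayley_dist G S \<one> h | h. h \<in> H}"
    using finite_subset[OF sub(1) fin] by simp
  have "cayley_dist G S \<one> h \<le> k" if "h \<in> H" for h
    using that sub ball cayley_dist_le_iff[OF sym gen] by blast
  then show ?thesis
    unfolding subgroup_diam_def using sub fin' by (subst Max_le_iff) auto
qed

section \<open>Cosets and Cayley graphs of quotient groups\<close>

lemma r_coset_eq_iff:
  assumes N: "N \<lhd> G" and "x \<in> carrier G" "y \<in> carrier G"
  shows "N #> x = N #> y \<longleftrightarrow> x \<otimes> inv y \<in> N"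
proof -
  interpret N: normal N G by fact
  have sub: "subgroup N G" by (rule N.subgroup_axioms)
  show ?thesis
  proof
    assume "N #> x = N #> y"
    then have "x \<in> N #> y" using rcos_self[OF assms(2) sub] by simp
    then show "x \<otimes> inv y \<in> N"
      using N.rcos_module[OF is_group assms(3,2)] by simp
  next
    assume "x \<otimes> inv y \<in> N"
    then have "x \<in> N #> y"
      using N.rcos_module[OF is_group assms(3,2)] by simp
    then show "N #> x = N #> y"
      using repr_independence[OF _ assms(3) sub] by simp
  qed
qed

lemma r_coset_mult_cong:
  assumes N: "N \<lhd> G"
    and "x \<in> carrier G" "x' \<in> carrier G" "y \<in> carrier G" "y' \<in> carrier G"
    and "N #> x = N #> x'" "N #> y = N #> y'"
  shows "N #> (x \<otimes> y) = N #> (x' \<otimes> y')"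
  using normal.rcos_sum[OF N, of x y] normal.rcos_sum[OF N, of x' y'] assms(2-) by simp

lemma r_coset_pow_cong:
  assumes N: "N \<lhd> G" and "x \<in> carrier G" "y \<in> carrier G" "N #> x = N #> y"
  shows "N #> (x [^] (n::nat)) = N #> (y [^] n)"
proof (induction n)
  case (Suc n)
  then show ?case
    using r_coset_mult_cong[OF N, of "x [^] n" "y [^] n" x y] assms by simp
qed simp

lemma word_prod_FactGroup:
  assumes N: "N \<lhd> G"
  shows "set ws \<subseteq> carrier G \<Longrightarrow>
    word_prod (G Mod N) (map (\<lambda>w. N #> w) ws) = N #> word_prod G ws"
proof (induction ws)
  case Nil
  then show ?case
    using N by (auto simp: FactGroup_def normal_imp_subgroup subgroup.subset coset_mult_one)
next
  case (Cons w ws)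
  then show ?case
    using normal.rcos_sum[OF N, of w "word_prod G ws"] by (auto simp: FactGroup_def)
qed

lemma coset_image_symmetric:
  assumes N: "N \<lhd> G" and sym: "symmetric_subset G S"
  shows "symmetric_subset (G Mod N) (coset_image G S N)"
proof -
  interpret Q: group "G Mod N"
    using normal.factorgroup_is_group[OF N] .
  have S: "S \<subseteq> carrier G" "\<And>s. s \<in> S \<Longrightarrow> inv s \<in> S"
    using sym by (auto simp: symmetric_subset_def)
  have sub: "coset_image G S N \<subseteq> carrier (G Mod N)"
    using S by (auto simp: coset_image_def FactGroup_def RCOSETS_def)
  have inv: "inv\<^bsub>G Mod N\<^esub> A \<in> coset_image G S N" if A: "A \<in> coset_image G S N" for A
  proof -
    obtain s where s: "s \<in> S" "A = N #> s"
      using A by (auto simp: coset_image_def)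
    have "inv\<^bsub>G Mod N\<^esub> A = N #> inv s"
      using s S sub A normal.inv_FactGroup[OF N, of A] normal.rcos_inv[OF N, of s] by blast
    then show ?thesis
      using s S by (auto simp: coset_image_def)
  qed
  show ?thesis
    unfolding symmetric_subset_def using sub inv Q.inv_inv by metis
qed

text \<open>A word of cosets lifts letter by letter to a word over \<open>S\<close> of the same
  length. The lift represents the coset of \<open>h\<close> but need not equal
  \<open>h\<close>.\<close>

lemma coset_in_word_ball_iff:
  assumes N: "N \<lhd> G" and S: "S \<subseteq> carrier G"
  shows "N #> h \<in> word_ball (G Mod N) (coset_image G S N) k \<longleftrightarrow>
    (\<exists>w \<in> word_ball G S k. N #> w = N #> h)"
proof
  assume "N #> h \<in> word_ball (G Mod N) (coset_image G S N) k"
  then obtain Ws where Ws: "set Ws \<subseteq> coset_image G S N" "length Ws \<le> k"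
      "N #> h = word_prod (G Mod N) Ws"
    by (rule word_ballE)
  have "Ws \<in> lists ((\<lambda>w. N #> w) ` S)"
    using Ws(1) by (auto simp: coset_image_def)
  then obtain ws where ws: "ws \<in> lists S" "Ws = map (\<lambda>w. N #> w) ws"
    by (auto simp: lists_image)
  then have "N #> word_prod G ws = N #> h"
    using Ws S word_prod_FactGroup[OF N, of ws] by auto
  then show "\<exists>w \<in> word_ball G S k. N #> w = N #> h"
    using ws Ws by (intro bexI[of _ "word_prod G ws"] word_ballI) auto
next
  assume "\<exists>w \<in> word_ball G S k. N #> w = N #> h"
  then obtain ws where ws: "set ws \<subseteq> S" "length ws \<le> k" "N #> word_prod G ws = N #> h"
    by (auto elim!: word_ballE)
  then have "N #> h = word_prod (G Mod N) (map (\<lambda>w. N #> w) ws)"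
    using S word_prod_FactGroup[OF N, of ws] by auto
  then show "N #> h \<in> word_ball (G Mod N) (coset_image G S N) k"
    using ws by (simp only:) (rule word_ballI, auto simp: coset_image_def)
qed

lemma coset_image_generate:
  assumes N: "N \<lhd> G" and sym: "symmetric_subset G S" and gen: "generate G S = carrier G"
  shows "generate (G Mod N) (coset_image G S N) = carrier (G Mod N)"
proof -
  interpret Q: group "G Mod N"
    using normal.factorgroup_is_group[OF N] .
  have S: "S \<subseteq> carrier G"
    using sym by (auto simp: symmetric_subset_def)
  have sub: "coset_image G S N \<subseteq> carrier (G Mod N)"
    using coset_image_symmetric[OF N sym] by (simp add: symmetric_subset_def)
  have gen_word: "word_prod (G Mod N) Ws \<in> generate (G Mod N) (coset_image G S N)"
    if "set Ws \<subseteq> coset_image G S N" for Ws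
    using that
  proof (induction Ws)
    case Nil
    show ?case unfolding word_prod.simps by (rule generate.one)
  next
    case (Cons W Ws)
    then show ?case unfolding word_prod.simps by (auto intro!: generate.eng intro: generate.incl simp del: mult_FactGroup)
  qed
  have "A \<in> generate (G Mod N) (coset_image G S N)" if A: "A \<in> carrier (G Mod N)" for A
  proof -
    obtain g where g: "g \<in> carrier G" "A = N #> g"
      using A by (auto simp: FactGroup_def RCOSETS_def)
    then obtain k where "g \<in> word_ball G S k"
      using word_ball_generate[OF sym] gen by blast
    then have "A \<in> word_ball (G Mod N) (coset_image G S N) k"
      unfolding g coset_in_word_ball_iff[OF N S] by blast
    then show ?thesis
      using gen_word by (auto elim: word_ballE)
  qed
  then show ?thesis
    using Q.generate_in_carrier[OF sub] by blast
qed

text \<open>This turns diameters of quotients into the existence of short representatives in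
  \<open>G\<close> itself. Both directions are used: one to bound the factors of the series, the
  other to exploit the diameter of the abelianization.\<close>

lemma quotient_diam_le_iff:
  assumes sym: "symmetric_subset G S" and gen: "generate G S = carrier G"
    and fin: "finite (carrier G)" and N: "N \<lhd> G" and H: "subgroup H G"
  shows "quotient_diam G S H N \<le> k \<longleftrightarrow> (\<forall>h\<in>H. \<exists>w\<in>word_ball G S k. N #> w = N #> h)"
proof -
  interpret Q: group "G Mod N"
    using normal.factorgroup_is_group[OF N] .
  have S: "S \<subseteq> carrier G"
    using sym by (auto simp: symmetric_subset_def)
  have sub: "H \<subseteq> carrier G" "\<one> \<in> H"
    using H by (auto simp: subgroup.subset subgroup.one_closed)
  have fin': "finite {cayley_dist (G Mod N) (coset_image G S N) N (N #> h) | h. h \<in> H}"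
    using finite_subset[OF sub(1) fin] by simp
  have dist: "cayley_dist (G Mod N) (coset_image G S N) N (N #> h) \<le> k \<longleftrightarrow>
      (\<exists>w\<in>word_ball G S k. N #> w = N #> h)" if h: "h \<in> H" for h
  proof -
    have "N #> h \<in> carrier (G Mod N)"
      using h sub by (auto simp: FactGroup_def RCOSETS_def)
    then show ?thesis
      using Q.cayley_dist_le_iff[OF coset_image_symmetric[OF N sym] coset_image_generate[OF N sym gen]]
        coset_in_word_ball_iff[OF N S]
      by (simp add: FactGroup_def)
  qed
  have "quotient_diam G S H N \<le> k \<longleftrightarrow>
      (\<forall>h\<in>H. cayley_dist (G Mod N) (coset_image G S N) N (N #> h) \<le> k)"
    unfolding quotient_diam_def using sub fin' by (subst Max_le_iff) auto
  with dist show ?thesis by blast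
qed

end

section \<open>Commutator calculus modulo the lower central series\<close>

context group
begin

text \<open>With products bracketed to the right, an element meets its inverse in exactly these two
  shapes. Together with \<open>m_assoc\<close> and \<open>inv_mult_group\<close> these rules verify
  commutator identities by rewriting.\<close>

lemma m_inv_cancel_left:
  assumes "x \<in> carrier G" "y \<in> carrier G"
  shows "x \<otimes> (inv x \<otimes> y) = y" "inv x \<otimes> (x \<otimes> y) = y"
  using assms by (simp_all add: m_assoc[symmetric])

lemmas group_word_simps = m_assoc inv_mult_group m_inv_cancel_left

lemma commutator_closed [simp]:
  "x \<in> carrier G \<Longrightarrow> y \<in> carrier G \<Longrightarrow> commutator G x y \<in> carrier G"
  by (simp add: commutator_def)

lemma commutator_one [simp]:
  "x \<in> carrier G \<Longrightarrow> commutator G x \<one> = \<one>" "x \<in> carrier G \<Longrightarrow> commutator G \<one> x = \<one>"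
  by (simp_all add: commutator_def)

text \<open>The recursion starts at index 1, index 0 being a dummy; this is why later statements
  speak of \<open>Suc n\<close> rather than \<open>n\<close>.\<close>

lemma lower_central_Suc_Suc:
  "lower_central G (Suc (Suc n)) =
     generate G (\<Union>h\<in>lower_central G (Suc n). \<Union>k\<in>carrier G. {commutator G h k})"
  by (simp add: commutator_subgroup_def commutator_def)

declare lower_central.simps(3) [simp del]

text \<open>Conjugating \<open>[h, k]\<close> by \<open>g\<close> conjugates both entries, and the
  conjugate of \<open>h\<close> stays in the preceding term by induction. So the set of generators
  is invariant under conjugation.\<close>

lemma lower_central_normal: "lower_central G n \<lhd> G"
proof (induction n rule: induct_nat_012)
  case (ge2 n)
  let ?H = "\<Union>h\<in>lower_central G (Suc n). \<Union>k\<in>carrier G. {commutator G h k}"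
  interpret N: normal "lower_central G (Suc n)" G by (rule ge2)
  show ?case
    unfolding lower_central_Suc_Suc
  proof (rule normal_generateI)
    show "?H \<subseteq> carrier G"
      using N.subset by auto
  next
    fix c g
    assume c: "c \<in> ?H" and g: "g \<in> carrier G"
    then obtain h k where hk: "h \<in> lower_central G (Suc n)" "k \<in> carrier G" "c = commutator G h k"
      by blast
    then have h: "h \<in> carrier G"
      using N.subset by blast
    have "g \<otimes> c \<otimes> inv g = commutator G (g \<otimes> h \<otimes> inv g) (g \<otimes> k \<otimes> inv g)"
      using g h hk by (simp add: commutator_def group_word_simps)
    moreover have "g \<otimes> h \<otimes> inv g \<in> lower_central G (Suc n)"
      using N.inv_op_closed2[OF g hk(1)] .
    ultimately show "g \<otimes> c \<otimes> inv g \<in> ?H"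
      using g hk(2) by blast
  qed
qed (auto intro!: normal_invI[OF subgroup_self])

lemma lower_central_subgroup: "subgroup (lower_central G n) G"
  by (rule normal_imp_subgroup[OF lower_central_normal])

lemma lower_central_carrier: "x \<in> lower_central G n \<Longrightarrow> x \<in> carrier G"
  by (rule subgroup.mem_carrier[OF lower_central_subgroup])

lemma commutator_in_lower_central:
  "x \<in> lower_central G (Suc n) \<Longrightarrow> y \<in> carrier G \<Longrightarrow>
    commutator G x y \<in> lower_central G (Suc (Suc n))"
  unfolding lower_central_Suc_Suc by (rule generate.incl) blast

text \<open>By normality \<open>[h, k]\<close> is a product of two elements of the term containing
  \<open>h\<close>, namely \<open>h\<close> and the conjugate of its inverse by
  \<open>k\<close>.\<close>

lemma lower_central_Suc_subset: "lower_central G (Suc (Suc n)) \<subseteq> lower_central G (Suc n)"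
proof -
  interpret N: normal "lower_central G (Suc n)" G by (rule lower_central_normal)
  have "commutator G h k \<in> lower_central G (Suc n)"
    if h: "h \<in> lower_central G (Suc n)" and k: "k \<in> carrier G" for h k
  proof -
    have "h \<otimes> (k \<otimes> inv h \<otimes> inv k) \<in> lower_central G (Suc n)"
      using N.inv_op_closed2[OF k N.m_inv_closed[OF h]] h by blast
    then show ?thesis
      using h k N.subset by (auto simp: commutator_def m_assoc subset_iff)
  qed
  then show ?thesis
    unfolding lower_central_Suc_Suc
    by (intro generate_subgroup_incl lower_central_subgroup) auto
qed

text \<open>Congruence modulo a term of the series, written as equality of cosets. Transitivity is
  then that of \<open>=\<close>, so calculations can be chained with \<open>also\<close>.\<close>

abbreviation lc_eq :: "nat \<Rightarrow> 'a \<Rightarrow> 'a \<Rightarrow> bool" where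
  "lc_eq n x y \<equiv> lower_central G n #> x = lower_central G n #> y"

lemma lc_eq_mult:
  "lc_eq n x x' \<Longrightarrow> lc_eq n y y' \<Longrightarrow> x \<in> carrier G \<Longrightarrow> x' \<in> carrier G \<Longrightarrow>
    y \<in> carrier G \<Longrightarrow> y' \<in> carrier G \<Longrightarrow> lc_eq n (x \<otimes> y) (x' \<otimes> y')"
  by (rule r_coset_mult_cong[OF lower_central_normal])

lemma lc_eq_one: "x \<in> lower_central G n \<Longrightarrow> lc_eq n x \<one>"
  using lower_central_carrier by (subst r_coset_eq_iff[OF lower_central_normal]) auto

lemma lc_eq_absorb:
  assumes "g \<in> lower_central G n" "x \<in> carrier G"
  shows "lc_eq n (g \<otimes> x) x"
  using lc_eq_mult[OF lc_eq_one[OF assms(1)], of x x] assms lower_central_carrier by auto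

lemma lc_eqE:
  assumes "lc_eq n x y" "x \<in> carrier G" "y \<in> carrier G"
  obtains g where "g \<in> lower_central G n" "x = g \<otimes> y"
proof
  show "x \<otimes> inv y \<in> lower_central G n"
    using assms by (simp add: r_coset_eq_iff[OF lower_central_normal])
  show "x = x \<otimes> inv y \<otimes> y"
    using assms by (simp add: m_assoc)
qed

text \<open>Since \<open>z x = [z, x] x z\<close> and \<open>[z, x]\<close> lies one term deeper,
  each term of the series is central modulo the next.\<close>

lemma lc_central:
  assumes z: "z \<in> lower_central G (Suc n)" and x: "x \<in> carrier G"
  shows "lc_eq (Suc (Suc n)) (z \<otimes> x) (x \<otimes> z)"
proof -
  have zc: "z \<in> carrier G" using z lower_central_carrier by blast
  have "z \<otimes> x = commutator G z x \<otimes> (x \<otimes> z)"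
    using zc x by (simp add: commutator_def group_word_simps)
  then show ?thesis
    using lc_eq_absorb[OF commutator_in_lower_central[OF z x], of "x \<otimes> z"] zc x by simp
qed

lemma lc_conj:
  assumes z: "z \<in> lower_central G (Suc n)" and x: "x \<in> carrier G"
  shows "lc_eq (Suc (Suc n)) (x \<otimes> z \<otimes> inv x) z"
proof -
  have zc: "z \<in> carrier G" using z lower_central_carrier by blast
  have "lc_eq (Suc (Suc n)) (x \<otimes> z \<otimes> inv x) (z \<otimes> x \<otimes> inv x)"
    using zc x by (intro lc_eq_mult lc_central[OF z x, symmetric]) auto
  then show ?thesis using zc x by (simp add: m_assoc)
qed

section \<open>Bilinearity of the commutator modulo deeper terms\<close>

text \<open>The exact identity is \<open>[x x', y] = (x [x', y] x^-1) [x, y]\<close>. Modulo the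
  next term \<open>[x', y]\<close> is central, so the conjugation disappears and the two factors may
  be swapped.\<close>

lemma commutator_mult_left:
  assumes x: "x \<in> lower_central G (Suc n)" "x' \<in> lower_central G (Suc n)" and y: "y \<in> carrier G"
  shows "lc_eq (Suc (Suc (Suc n))) (commutator G (x \<otimes> x') y) (commutator G x y \<otimes> commutator G x' y)"
proof -
  have xc: "x \<in> carrier G" "x' \<in> carrier G" using x lower_central_carrier by blast+
  let ?z = "commutator G x' y"
  have z: "?z \<in> lower_central G (Suc (Suc n))"
    using x y by (intro commutator_in_lower_central)
  have "commutator G (x \<otimes> x') y = (x \<otimes> ?z \<otimes> inv x) \<otimes> commutator G x y"
    using xc y by (simp add: commutator_def group_word_simps)
  moreover have "lc_eq (Suc (Suc (Suc n))) ((x \<otimes> ?z \<otimes> inv x) \<otimes> commutator G x y) (?z \<otimes> commutator G x y)"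
    using xc y by (intro lc_eq_mult lc_conj z) auto
  ultimately show ?thesis
    using lc_central[OF z, of "commutator G x y"] xc y by simp
qed

text \<open>Here the identity is \<open>[x, y y'] = [x, y] (y [x, y'] y^-1)\<close>, and only the
  conjugation has to be removed.\<close>

lemma commutator_mult_right:
  assumes x: "x \<in> lower_central G (Suc n)" and y: "y \<in> carrier G" "y' \<in> carrier G"
  shows "lc_eq (Suc (Suc (Suc n))) (commutator G x (y \<otimes> y')) (commutator G x y \<otimes> commutator G x y')"
proof -
  have xc: "x \<in> carrier G" using x lower_central_carrier by blast
  let ?z = "commutator G x y'"
  have z: "?z \<in> lower_central G (Suc (Suc n))"
    using x y by (intro commutator_in_lower_central)
  have "commutator G x (y \<otimes> y') = commutator G x y \<otimes> (y \<otimes> ?z \<otimes> inv y)"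
    using xc y by (simp add: commutator_def group_word_simps)
  moreover have "lc_eq (Suc (Suc (Suc n))) (commutator G x y \<otimes> (y \<otimes> ?z \<otimes> inv y)) (commutator G x y \<otimes> ?z)"
    using xc y by (intro lc_eq_mult lc_conj z) auto
  ultimately show ?thesis by simp
qed

text \<open>Write \<open>x = g x'\<close> with \<open>g\<close> one term deeper; then
  \<open>[g, y]\<close> already lies in the modulus. Each commutator thus improves a congruence by
  one term.\<close>

lemma commutator_cong_left:
  assumes x: "x \<in> lower_central G (Suc n)" "x' \<in> lower_central G (Suc n)" and y: "y \<in> carrier G"
    and eq: "lc_eq (Suc (Suc n)) x x'"
  shows "lc_eq (Suc (Suc (Suc n))) (commutator G x y) (commutator G x' y)"
proof -
  have xc: "x \<in> carrier G" "x' \<in> carrier G" using x lower_central_carrier by blast+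
  obtain g where g: "g \<in> lower_central G (Suc (Suc n))" "x = g \<otimes> x'"
    using lc_eqE[OF eq xc] .
  have "lc_eq (Suc (Suc (Suc n))) (commutator G x y) (commutator G g y \<otimes> commutator G x' y)"
    unfolding g(2) using g(1) lower_central_Suc_subset[of n] x y
    by (intro commutator_mult_left) blast+
  also have "lower_central G (Suc (Suc (Suc n))) #> (commutator G g y \<otimes> commutator G x' y) =
      lower_central G (Suc (Suc (Suc n))) #> commutator G x' y"
    using g(1) xc y by (intro lc_eq_absorb commutator_in_lower_central) simp_all
  finally show ?thesis .
qed

lemma lower_central_pow: "x \<in> lower_central G n \<Longrightarrow> x [^] (k::nat) \<in> lower_central G n"
  by (induction k)
    (simp_all add: subgroup.one_closed[OF lower_central_subgroup] subgroup.m_closed[OF lower_central_subgroup])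

lemma commutator_pow_left:
  assumes x: "x \<in> lower_central G (Suc n)" and y: "y \<in> carrier G"
  shows "lc_eq (Suc (Suc (Suc n))) (commutator G (x [^] (k::nat)) y) (commutator G x y [^] k)"
proof (induction k)
  case (Suc k)
  have xc: "x \<in> carrier G" using x lower_central_carrier by blast
  have "lc_eq (Suc (Suc (Suc n))) (commutator G (x [^] k \<otimes> x) y)
      (commutator G (x [^] k) y \<otimes> commutator G x y)"
    using x y by (intro commutator_mult_left lower_central_pow)
  also have "lower_central G (Suc (Suc (Suc n))) #> (commutator G (x [^] k) y \<otimes> commutator G x y) =
    lower_central G (Suc (Suc (Suc n))) #> (commutator G x y [^] k \<otimes> commutator G x y)"
    using xc y Suc by (intro lc_eq_mult) auto
  finally show ?case by simp
qed (use y in simp)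

lemma commutator_pow_right:
  assumes x: "x \<in> lower_central G (Suc n)" and y: "y \<in> carrier G"
  shows "lc_eq (Suc (Suc (Suc n))) (commutator G x (y [^] (k::nat))) (commutator G x y [^] k)"
proof (induction k)
  case 0
  then show ?case using lower_central_carrier[OF x] by simp
next
  case (Suc k)
  have xc: "x \<in> carrier G" using x lower_central_carrier by blast
  have "lc_eq (Suc (Suc (Suc n))) (commutator G x (y [^] k \<otimes> y))
      (commutator G x (y [^] k) \<otimes> commutator G x y)"
    using x y by (intro commutator_mult_right) auto
  also have "lower_central G (Suc (Suc (Suc n))) #> (commutator G x (y [^] k) \<otimes> commutator G x y) =
    lower_central G (Suc (Suc (Suc n))) #> (commutator G x y [^] k \<otimes> commutator G x y)"
    using xc y Suc by (intro lc_eq_mult) auto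
  finally show ?case by simp
qed

text \<open>The depth of the first entry is a parameter: \<open>k = 0\<close> covers arbitrary
  elements, while \<open>k = 1\<close> shows that a first entry in \<open>G_2\<close> pushes the
  result one term deeper.\<close>

lemma iter_commutator_in_lower_central:
  assumes "x \<in> lower_central G (Suc k)"
  shows "set ys \<subseteq> carrier G \<Longrightarrow> iter_commutator G x ys \<in> lower_central G (Suc (k + length ys))"
  using assms by (induction ys) (simp_all add: commutator_in_lower_central)

lemma iter_commutator_closed [simp]:
  "x \<in> carrier G \<Longrightarrow> set ys \<subseteq> carrier G \<Longrightarrow> iter_commutator G x ys \<in> carrier G"
  by (induction ys) auto

text \<open>The induction hypothesis is a congruence between elements of one term modulo the next.
  Taking the commutator with \<open>y\<close> raises its modulus by
  \<open>commutator_cong_left\<close>, and \<open>commutator_mult_left\<close> then splits the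
  product.\<close>

lemma iter_commutator_mult:
  assumes x: "x \<in> carrier G" "x' \<in> carrier G"
  shows "set ys \<subseteq> carrier G \<Longrightarrow> lc_eq (Suc (Suc (length ys)))
    (iter_commutator G (x \<otimes> x') ys) (iter_commutator G x ys \<otimes> iter_commutator G x' ys)"
proof (induction ys)
  case (Cons y ys)
  have lc: "iter_commutator G u ys \<in> lower_central G (Suc (length ys))" if "u \<in> carrier G" for u
    using iter_commutator_in_lower_central[of u 0 ys] that Cons.prems by simp
  have y: "y \<in> carrier G" and ys: "set ys \<subseteq> carrier G" using Cons.prems by auto
  have "lc_eq (Suc (Suc (Suc (length ys)))) (commutator G (iter_commutator G (x \<otimes> x') ys) y)
     (commutator G (iter_commutator G x ys \<otimes> iter_commutator G x' ys) y)"
    using x y lc Cons.IH[OF ys] subgroup.m_closed[OF lower_central_subgroup]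
    by (intro commutator_cong_left) auto
  then show ?case
    using commutator_mult_left[OF lc[OF x(1)] lc[OF x(2)] y] by simp
qed simp

lemma iter_commutator_one: "set ys \<subseteq> carrier G \<Longrightarrow> iter_commutator G \<one> ys = \<one>"
  by (induction ys) auto

text \<open>The discrepancy \<open>g\<close> between \<open>x\<close> and \<open>x'\<close> lies in
  \<open>G_2\<close>, so its iterated commutator vanishes modulo the relevant term. This is how the
  diameter of the abelianization enters.\<close>

lemma iter_commutator_cong:
  assumes x: "x \<in> carrier G" "x' \<in> carrier G" and eq: "lc_eq 2 x x'" and ys: "set ys \<subseteq> carrier G"
  shows "lc_eq (Suc (Suc (length ys))) (iter_commutator G x ys) (iter_commutator G x' ys)"
proof -
  obtain g where g: "g \<in> lower_central G 2" "x = g \<otimes> x'"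
    using lc_eqE[OF eq x] .
  have gc: "g \<in> carrier G" using g lower_central_carrier by blast
  have "iter_commutator G g ys \<in> lower_central G (Suc (Suc (length ys)))"
    using iter_commutator_in_lower_central[of g 1 ys] g ys by (simp add: numeral_2_eq_2)
  then have "lc_eq (Suc (Suc (length ys))) (iter_commutator G g ys \<otimes> iter_commutator G x' ys)
      (iter_commutator G x' ys)"
    using x ys by (intro lc_eq_absorb) auto
  then show ?thesis
    using iter_commutator_mult[OF gc x(2) ys] g by simp
qed

end

section \<open>Short words for powers of iterated commutators\<close>

context group
begin

lemma lc_eq_pow:
  "lc_eq n x y \<Longrightarrow> x \<in> carrier G \<Longrightarrow> y \<in> carrier G \<Longrightarrow> lc_eq n (x [^] (k::nat)) (y [^] k)"
  by (rule r_coset_pow_cong[OF lower_central_normal])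

text \<open>The modulus is contained in the term in question. Hence a short word replacing an
  element of that term stays inside it, and bilinearity remains applicable.\<close>

lemma lc_eq_mem:
  assumes "lc_eq (Suc (Suc n)) w x" "x \<in> lower_central G (Suc n)" "w \<in> carrier G"
  shows "w \<in> lower_central G (Suc n)"
proof -
  obtain g where g: "g \<in> lower_central G (Suc (Suc n))" "w = g \<otimes> x"
    using lc_eqE[OF assms(1,3) lower_central_carrier[OF assms(2)]] .
  then have "g \<in> lower_central G (Suc n)"
    using lower_central_Suc_subset[of n] by blast
  then show ?thesis
    unfolding g(2) using assms(2) by (rule subgroup.m_closed[OF lower_central_subgroup])
qed

text \<open>One more commutator with a letter turns length \<open>l\<close> into
  \<open>2 (l + 1)\<close>, which is at most \<open>4 l\<close> for
  \<open>l \<ge> 1\<close>.\<close>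

lemma iter_commutator_in_word_ball:
  assumes sym: "symmetric_subset G S" and x: "x \<in> S"
  shows "set ys \<subseteq> S \<Longrightarrow> iter_commutator G x ys \<in> word_ball G S (4 ^ length ys)"
proof (induction ys)
  case Nil
  have "S \<subseteq> carrier G" using sym by (simp add: symmetric_subset_def)
  then show ?case using generator_in_word_ball x by simp
next
  case (Cons y ys)
  have "S \<subseteq> carrier G" using sym by (simp add: symmetric_subset_def)
  then have "commutator G (iter_commutator G x ys) y \<in> word_ball G S (2 * (4 ^ length ys + 1))"
    using Cons by (intro word_ball_commutator sym generator_in_word_ball) auto
  moreover have "2 * (4 ^ length ys + 1) \<le> (4::nat) ^ length (y # ys)"
    using one_le_power[of "4::nat" "length ys"] by simp
  ultimately have "commutator G (iter_commutator G x ys) y \<in> word_ball G S (4 ^ length (y # ys))"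
    by (rule word_ball_mono)
  then show ?case by simp
qed

text \<open>Horner's scheme: if \<open>b = m b' + a\<close>, then \<open>[c, y]\<^sup>b\<close> is congruent to
  \<open>[c\<^sup>b\<^sup>', y\<^sup>m] [c, y\<^sup>a]\<close>, where \<open>c\<^sup>b\<^sup>'\<close> may be replaced by a short word.\<close>

lemma iter_commutator_small_power:
  assumes sym: "symmetric_subset G S" and x: "x \<in> S" and m: "m \<ge> 1"
  shows "set ys \<subseteq> S \<Longrightarrow> b \<le> m ^ Suc (length ys) \<Longrightarrow>
    \<exists>w \<in> word_ball G S (8 ^ length ys * m). lc_eq (Suc (Suc (length ys))) w (iter_commutator G x ys [^] b)"
proof (induction ys arbitrary: b)
  case Nil
  have "S \<subseteq> carrier G" using sym by (simp add: symmetric_subset_def)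
  then have "x [^] b \<in> word_ball G S (b * 1)"
    using x by (intro word_ball_pow generator_in_word_ball)
  then have "x [^] b \<in> word_ball G S m"
    using Nil by (auto intro: word_ball_mono)
  then show ?case by (intro bexI[of _ "x [^] b"]) simp_all
next
  case (Cons y ys)
  let ?n = "length ys" and ?c = "iter_commutator G x ys"
  let ?k = "Suc (Suc (Suc (length ys)))"
  have S: "S \<subseteq> carrier G" using sym by (simp add: symmetric_subset_def)
  have y: "y \<in> S" "y \<in> carrier G" and ys: "set ys \<subseteq> S" "set ys \<subseteq> carrier G" and xc: "x \<in> carrier G"
    using Cons.prems S x by auto
  have c: "?c \<in> lower_central G (Suc ?n)"
    using iter_commutator_in_lower_central[of x 0 ys] xc ys by simp
  have cc: "?c \<in> carrier G" using xc ys by simp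
  define a b' where "a = b mod m" and "b' = b div m"
  have b: "b = b' * m + a" and a: "a \<le> m"
    using m by (auto simp: a_def b'_def less_imp_le)
  have "b' \<le> m ^ Suc ?n"
    using div_le_mono[OF Cons.prems(2), of m] m by (simp add: b'_def)
  then obtain w where w: "w \<in> word_ball G S (8 ^ ?n * m)" "lc_eq (Suc (Suc ?n)) w (?c [^] b')"
    using Cons.IH ys by blast
  have wc: "w \<in> carrier G" using word_ball_closed[OF S w(1)] .
  \<comment> \<open>Moving powers into the second entry is justified only for first entries in this
    term, so the replacement \<open>w\<close> must be shown to lie there.\<close>
  have w_lc: "w \<in> lower_central G (Suc ?n)"
    using lc_eq_mem[OF w(2) lower_central_pow[OF c] wc] .
  let ?z = "commutator G ?c y"
  have zc: "?z \<in> carrier G" using cc y by simp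
  let ?v = "commutator G w (y [^] m) \<otimes> commutator G ?c (y [^] a)"
  have "lc_eq ?k (commutator G w (y [^] m)) (commutator G w y [^] m)"
    by (rule commutator_pow_right[OF w_lc y(2)])
  also have "lower_central G ?k #> (commutator G w y [^] m) =
      lower_central G ?k #> (commutator G (?c [^] b') y [^] m)"
    using w_lc lower_central_pow[OF c] y w wc cc
    by (intro lc_eq_pow commutator_cong_left) simp_all
  also have "lower_central G ?k #> (commutator G (?c [^] b') y [^] m) =
      lower_central G ?k #> ((?z [^] b') [^] m)"
    using y cc zc by (intro lc_eq_pow commutator_pow_left[OF c]) simp_all
  also have "(?z [^] b') [^] m = ?z [^] (b' * m)"
    using zc by (rule nat_pow_pow)
  finally have "lc_eq ?k ?v (?z [^] (b' * m) \<otimes> ?z [^] a)"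
    using wc cc y by (intro lc_eq_mult commutator_pow_right[OF c]) simp_all
  then have eq: "lc_eq ?k ?v (?z [^] b)"
    using zc by (simp add: nat_pow_mult b)
  have "?v \<in> word_ball G S (2 * (8 ^ ?n * m + m * 1) + 2 * (4 ^ ?n + a * 1))"
    using w y ys x S
    by (intro word_ball_mult word_ball_commutator word_ball_pow generator_in_word_ball
        iter_commutator_in_word_ball sym) auto
  \<comment> \<open>With \<open>K = 8 ^ ?n * m\<close>, each of \<open>K\<close>, \<open>m\<close>,
    \<open>4 ^ ?n\<close> and \<open>a\<close> is at most \<open>K\<close> and occurs twice. This is
    the origin of the base 8.\<close>
  moreover have "2 * (8 ^ ?n * m + m * 1) + 2 * (4 ^ ?n + a * 1) \<le> 8 ^ Suc ?n * m"
  proof -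
    define K where "K = 8 ^ ?n * m"
    have "(4::nat) ^ ?n \<le> K" "m \<le> K"
      using m mult_le_mono[OF power_mono[of "4::nat" 8 ?n] m] by (auto simp: K_def)
    then have "2 * (K + m * 1) + 2 * (4 ^ ?n + a * 1) \<le> 8 * K"
      using a by simp
    then show ?thesis by (simp add: K_def)
  qed
  ultimately have "?v \<in> word_ball G S (8 ^ Suc ?n * m)"
    by (rule word_ball_mono)
  then show ?case
    using eq by (intro bexI[of _ ?v]) simp_all
qed

text \<open>Divide \<open>b\<close> by \<open>m ^ i\<close>, where \<open>i\<close> is
  \<open>Suc (length ys)\<close>: the word for the \<open>m ^ i\<close>-th power is repeated
  \<open>b div m ^ i\<close> times, and one more word covers the remainder.\<close>

lemma iter_commutator_power:
  assumes sym: "symmetric_subset G S" and x: "x \<in> S" and m: "m \<ge> 1" and ys: "set ys \<subseteq> S"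
  shows "\<exists>w \<in> word_ball G S ((b div m ^ Suc (length ys) + 1) * (8 ^ length ys * m)).
    lc_eq (Suc (Suc (length ys))) w (iter_commutator G x ys [^] b)"
proof -
  let ?M = "m ^ Suc (length ys)" and ?c = "iter_commutator G x ys" and ?k = "Suc (Suc (length ys))"
  have S: "S \<subseteq> carrier G" using sym by (simp add: symmetric_subset_def)
  have cc: "?c \<in> carrier G" using x ys S by (intro iter_commutator_closed) auto
  obtain v where v: "v \<in> word_ball G S (8 ^ length ys * m)" "lc_eq ?k v (?c [^] ?M)"
    using iter_commutator_small_power[OF sym x m ys] by blast
  have "b mod ?M \<le> ?M"
    using m by (simp add: less_imp_le)
  then obtain w where w: "w \<in> word_ball G S (8 ^ length ys * m)" "lc_eq ?k w (?c [^] (b mod ?M))"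
    using iter_commutator_small_power[OF sym x m ys] by blast
  have "v [^] (b div ?M) \<otimes> w \<in> word_ball G S (b div ?M * (8 ^ length ys * m) + 8 ^ length ys * m)"
    using v w by (intro word_ball_mult word_ball_pow S)
  moreover have "lc_eq ?k (v [^] (b div ?M) \<otimes> w) ((?c [^] ?M) [^] (b div ?M) \<otimes> ?c [^] (b mod ?M))"
    using v w cc word_ball_closed[OF S] by (intro lc_eq_mult lc_eq_pow) auto
  moreover have "(?c [^] ?M) [^] (b div ?M) \<otimes> ?c [^] (b mod ?M) = ?c [^] b"
    using cc by (simp add: nat_pow_pow nat_pow_mult del: power_Suc)
  ultimately show ?thesis
    by (intro bexI[of _ "v [^] (b div ?M) \<otimes> w"]) (simp_all add: add.commute)
qed

text \<open>The iterated commutator is multiplicative in its first entry, and its values are central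
  modulo the next term, so all occurrences of \<open>t\<close> can be collected in front.\<close>

lemma iter_commutator_extract_letter:
  assumes t: "t \<in> carrier G" and ys: "set ys \<subseteq> carrier G"
  shows "set ws \<subseteq> carrier G \<Longrightarrow> lc_eq (Suc (Suc (length ys)))
    (iter_commutator G (word_prod G ws) ys)
    (iter_commutator G t ys [^] count_list ws t \<otimes>
      iter_commutator G (word_prod G (filter (\<lambda>s. s \<noteq> t) ws)) ys)"
proof (induction ws)
  case Nil
  then show ?case using ys by (simp add: iter_commutator_one)
next
  case (Cons s ws)
  let ?k = "Suc (Suc (length ys))"
  let ?f = "\<lambda>u. iter_commutator G u ys" and ?c = "count_list ws t"
  let ?P = "word_prod G ws" and ?Q = "word_prod G (filter (\<lambda>s. s \<noteq> t) ws)"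
  have s: "s \<in> carrier G" and ws: "set ws \<subseteq> carrier G" using Cons.prems by auto
  have Pc: "?P \<in> carrier G" using ws by simp
  have Qc: "?Q \<in> carrier G" using ws by (intro word_prod_closed) auto
  have fc: "?f u \<in> carrier G" if "u \<in> carrier G" for u using that ys by simp
  have lc: "?f u \<in> lower_central G (Suc (length ys))" if "u \<in> carrier G" for u
    using iter_commutator_in_lower_central[of u 0 ys] that ys by simp
  have "lc_eq ?k (?f (s \<otimes> ?P)) (?f s \<otimes> ?f ?P)"
    by (rule iter_commutator_mult[OF s Pc ys])
  also have "lower_central G ?k #> (?f s \<otimes> ?f ?P) = lower_central G ?k #> (?f s \<otimes> (?f t [^] ?c \<otimes> ?f ?Q))"
    using s t Pc Qc fc Cons.IH[OF ws] by (intro lc_eq_mult) simp_all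
  finally have *: "lc_eq ?k (?f (s \<otimes> ?P)) (?f s \<otimes> (?f t [^] ?c \<otimes> ?f ?Q))" .
  show ?case
  proof (cases "s = t")
    case True
    have "?f t \<otimes> (?f t [^] ?c \<otimes> ?f ?Q) = ?f t [^] Suc ?c \<otimes> ?f ?Q"
      using fc[OF t] fc[OF Qc] by (simp add: m_assoc[symmetric] nat_pow_Suc2[symmetric] del: nat_pow_Suc)
    then show ?thesis using * True by simp
  next
    case False
    have "?f s \<otimes> (?f t [^] ?c \<otimes> ?f ?Q) = (?f s \<otimes> ?f t [^] ?c) \<otimes> ?f ?Q"
      using fc s t Qc by (simp add: m_assoc)
    also have "lower_central G ?k #> ((?f s \<otimes> ?f t [^] ?c) \<otimes> ?f ?Q) =
        lower_central G ?k #> ((?f t [^] ?c \<otimes> ?f s) \<otimes> ?f ?Q)"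
      using fc s t Qc lc by (intro lc_eq_mult lc_central) simp_all
    also have "(?f t [^] ?c \<otimes> ?f s) \<otimes> ?f ?Q = ?f t [^] ?c \<otimes> (?f s \<otimes> ?f ?Q)"
      using fc s t Qc by (simp add: m_assoc)
    also have "lower_central G ?k #> (?f t [^] ?c \<otimes> (?f s \<otimes> ?f ?Q)) =
        lower_central G ?k #> (?f t [^] ?c \<otimes> ?f (s \<otimes> ?Q))"
      using fc s t Qc iter_commutator_mult[OF s Qc ys, symmetric] by (intro lc_eq_mult) simp_all
    finally show ?thesis using * False by simp
  qed
qed

text \<open>Sort the word by its letters: a letter with multiplicity \<open>c\<close> costs
  \<open>(c div m\<^sup>i + 1) 8\<^sup>n m\<close> where \<open>i = n + 1\<close>, and the multiplicities add up to the length.\<close>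

lemma iter_commutator_word:
  assumes sym: "symmetric_subset G S" and m: "m \<ge> 1" and ys: "set ys \<subseteq> S"
    and T: "finite T" "T \<subseteq> S"
  shows "set ws \<subseteq> T \<Longrightarrow>
    \<exists>w \<in> word_ball G S ((length ws div m ^ Suc (length ys) + card T) * (8 ^ length ys * m)).
    lc_eq (Suc (Suc (length ys))) w (iter_commutator G (word_prod G ws) ys)"
  using T
proof (induction T arbitrary: ws)
  case empty
  have "S \<subseteq> carrier G" using sym by (simp add: symmetric_subset_def)
  then show ?case using ys empty one_in_word_ball by (force simp: iter_commutator_one)
next
  case (insert t T)
  let ?M = "m ^ Suc (length ys)" and ?k = "Suc (Suc (length ys))" and ?C = "8 ^ length ys * m"
  have S: "S \<subseteq> carrier G" using sym by (simp add: symmetric_subset_def)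
  have ysc: "set ys \<subseteq> carrier G" and wsc: "set ws \<subseteq> carrier G" and t: "t \<in> S" "t \<in> carrier G"
    using ys S insert.prems by blast+
  let ?vs = "filter (\<lambda>s. s \<noteq> t) ws" and ?c = "count_list ws t"
  have vsc: "set ?vs \<subseteq> carrier G" using wsc by auto
  have len: "length ws = ?c + length ?vs"
    by (induction ws) auto
  obtain u where u: "u \<in> word_ball G S ((?c div ?M + 1) * ?C)"
      "lc_eq ?k u (iter_commutator G t ys [^] ?c)"
    using iter_commutator_power[OF sym t(1) m ys] by blast
  obtain v where v: "v \<in> word_ball G S ((length ?vs div ?M + card T) * ?C)"
      "lc_eq ?k v (iter_commutator G (word_prod G ?vs) ys)"
    using insert.IH[of ?vs] insert.prems by auto
  have "lc_eq ?k (u \<otimes> v) (iter_commutator G t ys [^] ?c \<otimes> iter_commutator G (word_prod G ?vs) ys)"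
    using u v word_ball_closed[OF S] t ysc vsc by (intro lc_eq_mult) simp_all
  also note iter_commutator_extract_letter[OF t(2) ysc wsc, symmetric]
  finally have eq: "lc_eq ?k (u \<otimes> v) (iter_commutator G (word_prod G ws) ys)" .
  have "u \<otimes> v \<in> word_ball G S ((?c div ?M + 1) * ?C + (length ?vs div ?M + card T) * ?C)"
    using u v S by (intro word_ball_mult)
  moreover have "(?c div ?M + 1) * ?C + (length ?vs div ?M + card T) * ?C \<le>
      (length ws div ?M + card (insert t T)) * ?C"
  proof -
    \<comment> \<open>Integer division is superadditive, so the quotients of the single letters add
      up to at most that of the whole length.\<close>
    have "?c div ?M + length ?vs div ?M \<le> length ws div ?M"
      unfolding len by (simp add: div_add1_eq[of ?c])
    then have "(?c div ?M + 1) + (length ?vs div ?M + card T) \<le> length ws div ?M + card (insert t T)"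
      using insert by simp
    then show ?thesis
      unfolding add_mult_distrib[symmetric] by (rule mult_le_mono1)
  qed
  ultimately have "u \<otimes> v \<in> word_ball G S ((length ws div ?M + card (insert t T)) * ?C)"
    by (rule word_ball_mono)
  with eq show ?case by blast
qed

section \<open>Generation of the factors of the series\<close>

lemma word_prod_map_cong:
  assumes "\<And>s. s \<in> set ss \<Longrightarrow> lc_eq n (f s) (h s)"
    "\<And>s. s \<in> set ss \<Longrightarrow> f s \<in> carrier G" "\<And>s. s \<in> set ss \<Longrightarrow> h s \<in> carrier G"
  shows "lc_eq n (word_prod G (map f ss)) (word_prod G (map h ss))"
  using assms
proof (induction ss)
  case (Cons s ss)
  have "set (map f ss) \<subseteq> carrier G" "set (map h ss) \<subseteq> carrier G"
    using Cons.prems by auto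
  moreover have "lc_eq n (word_prod G (map f ss)) (word_prod G (map h ss))"
    by (rule Cons.IH) (use Cons.prems in simp_all)
  moreover have "lc_eq n (f s) (h s)" "f s \<in> carrier G" "h s \<in> carrier G"
    using Cons.prems(1)[of s] Cons.prems(2)[of s] Cons.prems(3)[of s] by simp_all
  ultimately show ?case
    unfolding list.map word_prod.simps by (intro lc_eq_mult word_prod_closed)
qed simp

text \<open>The values commute modulo the next term, so two products over the same list can be
  merged entry by entry.\<close>

lemma word_prod_map_mult:
  assumes "\<And>s. s \<in> set ss \<Longrightarrow> f s \<in> lower_central G (Suc n)"
    "\<And>s. s \<in> set ss \<Longrightarrow> h s \<in> lower_central G (Suc n)"
  shows "lc_eq (Suc (Suc n)) (word_prod G (map f ss) \<otimes> word_prod G (map h ss))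
    (word_prod G (map (\<lambda>s. f s \<otimes> h s) ss))"
  using assms
proof (induction ss)
  case (Cons s ss)
  let ?F = "word_prod G (map f ss)" and ?H = "word_prod G (map h ss)"
    and ?E = "word_prod G (map (\<lambda>s. f s \<otimes> h s) ss)" and ?N = "lower_central G (Suc (Suc n))"
  have fh: "f s \<in> lower_central G (Suc n)" "h s \<in> lower_central G (Suc n)"
    using Cons.prems by auto
  have fhc: "f u \<in> carrier G" "h u \<in> carrier G" if "u \<in> set (s # ss)" for u
    using Cons.prems that lower_central_carrier by blast+
  have c: "?F \<in> carrier G" "?H \<in> carrier G" "?E \<in> carrier G" "f s \<in> carrier G" "h s \<in> carrier G"
    using fhc by (auto intro!: word_prod_closed)
  have "(f s \<otimes> ?F) \<otimes> (h s \<otimes> ?H) = f s \<otimes> (?F \<otimes> h s) \<otimes> ?H"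
    using c by (simp add: m_assoc)
  also have "?N #> (f s \<otimes> (?F \<otimes> h s) \<otimes> ?H) = ?N #> (f s \<otimes> (h s \<otimes> ?F) \<otimes> ?H)"
    using c by (intro lc_eq_mult lc_central[OF fh(2), symmetric]) simp_all
  also have "f s \<otimes> (h s \<otimes> ?F) \<otimes> ?H = (f s \<otimes> h s) \<otimes> (?F \<otimes> ?H)"
    using c by (simp add: m_assoc)
  also have "?N #> ((f s \<otimes> h s) \<otimes> (?F \<otimes> ?H)) = ?N #> ((f s \<otimes> h s) \<otimes> ?E)"
    using c Cons.IH Cons.prems by (intro lc_eq_mult) simp_all
  finally show ?case by simp
qed simp

lemma word_prod_map_single:
  assumes "distinct ss" "s \<in> set ss" "a \<in> carrier G"
  shows "word_prod G (map (\<lambda>t. if t = s then a else \<one>) ss) = a"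
proof -
  have 0: "word_prod G (map (\<lambda>t. if t = s then a else \<one>) us) = \<one>" if "s \<notin> set us" for us
    using that by (induction us) auto
  show ?thesis
    using assms by (induction ss) (auto simp: 0)
qed

text \<open>The membership claim is proved along with the congruence because the inductive step
  needs it to apply bilinearity to the tail of the product.\<close>

lemma commutator_word_prod_left:
  assumes zs: "set zs \<subseteq> lower_central G (Suc n)" and y: "y \<in> carrier G"
  shows "lc_eq (Suc (Suc (Suc n))) (commutator G (word_prod G zs) y)
    (word_prod G (map (\<lambda>z. commutator G z y) zs))"
    and "word_prod G zs \<in> lower_central G (Suc n)"
  using zs
proof (induction zs)
  case Nil
  {
    case 1
    then show ?case using y by simp
  next
    case 2
    then show ?case by (simp add: subgroup.one_closed[OF lower_central_subgroup])
  }
next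
  case (Cons z zs)
  {
    case 1
    let ?N = "lower_central G (Suc (Suc (Suc n)))"
    have z: "z \<in> lower_central G (Suc n)" "set zs \<subseteq> lower_central G (Suc n)" using 1 by auto
    have zc: "z \<in> carrier G" "set zs \<subseteq> carrier G" using z lower_central_carrier by blast+
    have c: "word_prod G (map (\<lambda>z. commutator G z y) zs) \<in> carrier G"
      using zc y by (intro word_prod_closed) auto
    have "lc_eq (Suc (Suc (Suc n))) (commutator G (z \<otimes> word_prod G zs) y)
        (commutator G z y \<otimes> commutator G (word_prod G zs) y)"
      using z Cons.IH(2) y by (intro commutator_mult_left) auto
    also have "?N #> (commutator G z y \<otimes> commutator G (word_prod G zs) y) =
        ?N #> (commutator G z y \<otimes> word_prod G (map (\<lambda>z. commutator G z y) zs))"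
      using zc y c Cons.IH(1) z(2) by (intro lc_eq_mult) simp_all
    finally show ?case by simp
  next
    case 2
    then show ?case
      using Cons.IH(2) by (simp add: subgroup.m_closed[OF lower_central_subgroup])
  }
qed

text \<open>Second entries decompose into letters of \<open>S\<close>, and all commutators with the
  same letter \<open>s\<close> merge into one by multiplicativity in the first entry. So one factor
  per letter suffices, however long the original product was.\<close>

lemma lower_central_generator_commutators:
  assumes sym: "symmetric_subset G S" and gen: "generate G S = carrier G"
    and ss: "distinct ss" "set ss = S" and g: "g \<in> lower_central G (Suc (Suc n))"
  shows "\<exists>h. (\<forall>s\<in>S. h s \<in> lower_central G (Suc n)) \<and>
    lc_eq (Suc (Suc (Suc n))) g (word_prod G (map (\<lambda>s. commutator G (h s) s) ss))"
proof -
  let ?lc = "lower_central G (Suc n)" and ?k = "Suc (Suc (Suc n))"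
  let ?w = "\<lambda>h. word_prod G (map (\<lambda>s. commutator G (h s) s) ss)"
  define K where "K = {g \<in> carrier G. \<exists>h. (\<forall>s\<in>S. h s \<in> ?lc) \<and> lc_eq ?k g (?w h)}"
  have S: "S \<subseteq> carrier G" "\<And>s. s \<in> S \<Longrightarrow> inv s \<in> S"
    using sym by (auto simp: symmetric_subset_def)
  have w_closed: "?w h \<in> carrier G" if "\<forall>s\<in>S. h s \<in> ?lc" for h
    using that S ss lower_central_carrier by (intro word_prod_closed) (auto intro!: commutator_closed)
  have K_cong: "x \<in> K" if "y \<in> K" "lc_eq ?k x y" "x \<in> carrier G" for x y
    using that by (auto simp: K_def)
  have K_mult: "x \<otimes> y \<in> K" if xy: "x \<in> K" "y \<in> K" for x y
  proof -
    obtain h where h: "\<forall>s\<in>S. h s \<in> ?lc" "lc_eq ?k x (?w h)" "x \<in> carrier G"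
      using xy by (auto simp: K_def)
    obtain h' where h': "\<forall>s\<in>S. h' s \<in> ?lc" "lc_eq ?k y (?w h')" "y \<in> carrier G"
      using xy by (auto simp: K_def)
    have hc: "h s \<in> carrier G" "h' s \<in> carrier G" if "s \<in> S" for s
      using that h h' lower_central_carrier by blast+
    have "lc_eq ?k (x \<otimes> y) (?w h \<otimes> ?w h')"
      using h h' w_closed by (intro lc_eq_mult) auto
    also have "lower_central G ?k #> (?w h \<otimes> ?w h') = lower_central G ?k #>
        word_prod G (map (\<lambda>s. commutator G (h s) s \<otimes> commutator G (h' s) s) ss)"
      using h h' S ss by (intro word_prod_map_mult commutator_in_lower_central) auto
    also have "\<dots> = lower_central G ?k #> ?w (\<lambda>s. h s \<otimes> h' s)"
      using h h' S ss hc by (intro word_prod_map_cong commutator_mult_left[symmetric]) auto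
    finally have "lc_eq ?k (x \<otimes> y) (?w (\<lambda>s. h s \<otimes> h' s))" .
    moreover have "\<forall>s\<in>S. h s \<otimes> h' s \<in> ?lc"
      using h h' by (simp add: subgroup.m_closed[OF lower_central_subgroup])
    ultimately show ?thesis
      unfolding K_def using h(3) h'(3)
      by (intro CollectI conjI exI[of _ "\<lambda>s. h s \<otimes> h' s"] m_closed)
  qed
  \<comment> \<open>The witness is \<open>h\<close> at the letter \<open>s\<close> and the identity
    elsewhere, since commutators with the identity are trivial.\<close>
  have K_gen: "commutator G h s \<in> K" if h: "h \<in> ?lc" and s: "s \<in> S" for h s
  proof -
    have hc: "h \<in> carrier G" using lower_central_carrier[OF h] .
    have "map (\<lambda>t. commutator G (if t = s then h else \<one>) t) ss =
        map (\<lambda>t. if t = s then commutator G h s else \<one>) ss"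
      using ss S by auto
    then have "?w (\<lambda>t. if t = s then h else \<one>) = commutator G h s"
      using word_prod_map_single[of ss s "commutator G h s"] ss s hc S
      by (simp only:) (auto intro!: commutator_closed)
    moreover have "\<forall>t\<in>S. (if t = s then h else \<one>) \<in> ?lc"
      using h by (simp add: subgroup.one_closed[OF lower_central_subgroup])
    ultimately show ?thesis
      unfolding K_def using hc s S(1)
      by (intro CollectI conjI exI[of _ "\<lambda>t. if t = s then h else \<one>"] commutator_closed) auto
  qed
  have K_one: "\<one> \<in> K"
  proof -
    have "?w (\<lambda>_. \<one>) = word_prod G (map (\<lambda>_. \<one>) ss)"
      using ss S by (intro arg_cong[where f = "word_prod G"]) auto
    also have "\<dots> = \<one>" by (induction ss) auto
    finally show ?thesis
      unfolding K_def
      by (auto intro!: exI[of _ "\<lambda>_. \<one>"] subgroup.one_closed[OF lower_central_subgroup])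
  qed
  have K_comm: "commutator G h y \<in> K" if h: "h \<in> ?lc" and y: "y \<in> generate G S" for h y
    using y
  proof induction
    case one
    then show ?case using K_one lower_central_carrier[OF h] by simp
  next
    case (incl s)
    then show ?case using K_gen[OF h] by blast
  next
    case (inv s)
    then show ?case using K_gen[OF h] S by blast
  next
    case (eng y y')
    have c: "y \<in> carrier G" "y' \<in> carrier G"
      using eng gen by auto
    then show ?case
      using K_cong[OF K_mult[OF eng.IH] commutator_mult_right[OF h c]] lower_central_carrier[OF h]
      by simp
  qed
  \<comment> \<open>From \<open>1 = [h^-1 h, y]\<close> and multiplicativity, the inverse of
    \<open>[h, y]\<close> is congruent to \<open>[h^-1, y]\<close>; this serves the inverse case of
    \<open>generate\<close>.\<close>
  have K_inv: "inv (commutator G h y) \<in> K" if h: "h \<in> ?lc" and y: "y \<in> carrier G" for h y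
  proof -
    have hc: "h \<in> carrier G" using lower_central_carrier[OF h] .
    have ih: "inv h \<in> ?lc" using h by (rule subgroup.m_inv_closed[OF lower_central_subgroup])
    let ?c = "commutator G h y"
    have "lc_eq ?k (commutator G (inv h \<otimes> h) y) (commutator G (inv h) y \<otimes> ?c)"
      using ih h y by (rule commutator_mult_left)
    then have "lc_eq ?k (\<one> \<otimes> inv ?c) (commutator G (inv h) y \<otimes> ?c \<otimes> inv ?c)"
      using hc y by (intro lc_eq_mult) simp_all
    then have "lc_eq ?k (inv ?c) (commutator G (inv h) y)"
      using hc y by (simp add: m_assoc)
    moreover have "commutator G (inv h) y \<in> K"
      using K_comm[OF ih] y gen by simp
    ultimately show ?thesis
      using K_cong hc y by simp
  qed
  have "g \<in> K"
    using g unfolding lower_central_Suc_Suc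
  proof induction
    case one
    then show ?case by (rule K_one)
  next
    case (incl c)
    then show ?case using K_comm gen by auto
  next
    case (inv c)
    then show ?case using K_inv by auto
  next
    case (eng x y)
    then show ?case using K_mult by blast
  qed
  then show ?thesis
    by (auto simp: K_def)
qed

lemma word_prod_concat_map:
  assumes "\<And>s. s \<in> set ss \<Longrightarrow> set (F s) \<subseteq> carrier G"
  shows "word_prod G (concat (map F ss)) = word_prod G (map (\<lambda>s. word_prod G (F s)) ss)"
  using assms
proof (induction ss)
  case (Cons s ss)
  have "set (concat (map F ss)) \<subseteq> carrier G" "set (F s) \<subseteq> carrier G"
    using Cons.prems by auto
  then show ?case
    using Cons by (simp add: word_prod_append)
qed simp

text \<open>Each first entry \<open>h s\<close> is expanded by the induction hypothesis and the
  commutator with \<open>s\<close> is distributed over the result. Every level multiplies the number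
  of factors by \<open>card S\<close>, starting from the single factor \<open>g\<close>.\<close>

lemma lower_central_iter_commutators:
  assumes sym: "symmetric_subset G S" and gen: "generate G S = carrier G" and fin: "finite S"
  shows "g \<in> lower_central G (Suc n) \<Longrightarrow>
    \<exists>zs. length zs = card S ^ n \<and> lc_eq (Suc (Suc n)) g (word_prod G zs) \<and>
      (\<forall>z\<in>set zs. \<exists>x\<in>carrier G. \<exists>ys. set ys \<subseteq> S \<and> length ys = n \<and> z = iter_commutator G x ys)"
proof (induction n arbitrary: g)
  case 0
  then show ?case
    using lower_central_carrier[OF 0] by (intro exI[of _ "[g]"]) (auto intro!: exI[of _ "[]"])
next
  case (Suc n)
  have S: "S \<subseteq> carrier G"
    using sym by (auto simp: symmetric_subset_def)
  let ?I = "\<lambda>n z. \<exists>x\<in>carrier G. \<exists>ys. set ys \<subseteq> S \<and> length ys = n \<and> z = iter_commutator G x ys"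
  obtain ss where ss: "distinct ss" "set ss = S"
    using finite_distinct_list[OF fin] by blast
  obtain h where h: "\<forall>s\<in>S. h s \<in> lower_central G (Suc n)"
      "lc_eq (Suc (Suc (Suc n))) g (word_prod G (map (\<lambda>s. commutator G (h s) s) ss))"
    using lower_central_generator_commutators[OF sym gen ss Suc.prems] by blast
  have "\<exists>F. \<forall>s\<in>S. length (F s) = card S ^ n \<and> lc_eq (Suc (Suc n)) (h s) (word_prod G (F s)) \<and>
      (\<forall>z\<in>set (F s). ?I n z)"
    using Suc.IH h(1) by (intro bchoice) blast
  then obtain F where F: "\<And>s. s \<in> S \<Longrightarrow> length (F s) = card S ^ n"
      "\<And>s. s \<in> S \<Longrightarrow> lc_eq (Suc (Suc n)) (h s) (word_prod G (F s))"
      "\<And>s z. s \<in> S \<Longrightarrow> z \<in> set (F s) \<Longrightarrow> ?I n z"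
    by metis
  have I_lc: "z \<in> lower_central G (Suc n)" if "?I n z" for z
    using that S iter_commutator_in_lower_central[of _ 0] by (auto simp: subset_iff)
  \<comment> \<open>Each letter contributes a block of \<open>card S ^ n\<close> commutators; the
    concatenation of the blocks over all letters is the required list.\<close>
  define E where "E = (\<lambda>s. map (\<lambda>z. commutator G z s) (F s))"
  have F_lc: "set (F s) \<subseteq> lower_central G (Suc n)" if "s \<in> S" for s
    using F(3)[OF that] I_lc by blast
  have E_closed: "set (E s) \<subseteq> carrier G" if "s \<in> S" for s
    using F_lc[OF that] that S lower_central_carrier by (auto simp: E_def intro!: commutator_closed)
  have eq: "lc_eq (Suc (Suc (Suc n))) (commutator G (h s) s) (word_prod G (E s))" if s: "s \<in> S" for s
  proof -
    have sc: "s \<in> carrier G" using s S by blast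
    have "lc_eq (Suc (Suc (Suc n))) (commutator G (h s) s) (commutator G (word_prod G (F s)) s)"
      using h(1) s sc F(2)[OF s] commutator_word_prod_left(2)[OF F_lc[OF s] sc]
      by (intro commutator_cong_left) auto
    also note commutator_word_prod_left(1)[OF F_lc[OF s] sc]
    finally show ?thesis by (simp add: E_def)
  qed
  have "lc_eq (Suc (Suc (Suc n))) (word_prod G (map (\<lambda>s. commutator G (h s) s) ss))
      (word_prod G (map (\<lambda>s. word_prod G (E s)) ss))"
    using h(1) S ss eq E_closed lower_central_carrier
    by (intro word_prod_map_cong) (auto intro!: commutator_closed)
  then have "lc_eq (Suc (Suc (Suc n))) g (word_prod G (concat (map E ss)))"
    using h(2) word_prod_concat_map[of ss E] E_closed ss by simp
  moreover have "length (concat (map E ss)) = card S ^ Suc n"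
  proof -
    have "map (length \<circ> E) ss = map (\<lambda>_. card S ^ n) ss"
      using F(1) ss by (simp add: E_def)
    then show ?thesis
      using distinct_card[OF ss(1)] ss(2)
      by (simp only: length_concat map_map sum_list_triv power_Suc of_nat_id)
  qed
  moreover have "?I (Suc n) z" if z: "z \<in> set (concat (map E ss))" for z
  proof -
    obtain s u where su: "s \<in> S" "u \<in> set (F s)" "z = commutator G u s"
      using z ss(2) by (auto simp: E_def)
    then obtain x ys where "x \<in> carrier G" "set ys \<subseteq> S" "length ys = n" "u = iter_commutator G x ys"
      using F(3) by blast
    then show ?thesis
      using su by (intro bexI[of _ x] exI[of _ "s # ys"]) auto
  qed
  ultimately show ?case by blast
qed

section \<open>Diameters\<close>

lemma word_ball_word_prod:
  assumes S: "S \<subseteq> carrier G"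
    and zs: "set zs \<subseteq> carrier G" "\<And>z. z \<in> set zs \<Longrightarrow> \<exists>w\<in>word_ball G S k. lc_eq n w z"
  shows "\<exists>w\<in>word_ball G S (length zs * k). lc_eq n w (word_prod G zs)"
  using zs
proof (induction zs)
  case Nil
  then show ?case using one_in_word_ball by force
next
  case (Cons z zs)
  obtain u where u: "u \<in> word_ball G S k" "lc_eq n u z"
    using Cons.prems(2)[of z] by auto
  obtain v where v: "v \<in> word_ball G S (length zs * k)" "lc_eq n v (word_prod G zs)"
    using Cons.IH Cons.prems by auto
  have "lc_eq n (u \<otimes> v) (z \<otimes> word_prod G zs)"
    using u v Cons.prems word_ball_closed[OF S] by (intro lc_eq_mult) auto
  moreover have "u \<otimes> v \<in> word_ball G S (k + length zs * k)"
    using u v by (intro word_ball_mult S)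
  ultimately show ?case by auto
qed

text \<open>There are \<open>card S ^ n\<close> commutators, and each costs what
  \<open>iter_commutator_word\<close> charges for a first entry of length at most \<open>D\<close>.
  The scale \<open>m\<close> stays free and is chosen in \<open>root_scale_bound\<close>.\<close>

lemma quotient_diam_lower_central_le:
  assumes sym: "symmetric_subset G S" and gen: "generate G S = carrier G"
    and fin: "finite (carrier G)" and m: "m \<ge> 1"
  defines "D \<equiv> quotient_diam G S (carrier G) (lower_central G 2)"
  shows "quotient_diam G S (lower_central G (Suc n)) (lower_central G (Suc (Suc n))) \<le>
    card S ^ n * ((D div m ^ Suc n + card S) * (8 ^ n * m))"
  unfolding quotient_diam_le_iff[OF sym gen fin lower_central_normal lower_central_subgroup]
proof
  fix g
  assume g: "g \<in> lower_central G (Suc n)"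
  have S: "S \<subseteq> carrier G"
    using sym by (auto simp: symmetric_subset_def)
  have finS: "finite S"
    using finite_subset[OF S fin] .
  let ?B = "(D div m ^ Suc n + card S) * (8 ^ n * m)"
  obtain zs where zs: "length zs = card S ^ n" "lc_eq (Suc (Suc n)) g (word_prod G zs)"
      "\<And>z. z \<in> set zs \<Longrightarrow> \<exists>x\<in>carrier G. \<exists>ys. set ys \<subseteq> S \<and> length ys = n \<and> z = iter_commutator G x ys"
    using lower_central_iter_commutators[OF sym gen finS g] by blast
  have ball: "\<exists>w\<in>word_ball G S ?B. lc_eq (Suc (Suc n)) w z" and zc: "z \<in> carrier G"
    if "z \<in> set zs" for z
  proof -
    obtain x ys where x: "x \<in> carrier G" and ys: "set ys \<subseteq> S" "length ys = n"
      and z: "z = iter_commutator G x ys"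
      using zs(3)[OF \<open>z \<in> set zs\<close>] by blast
    have ysc: "set ys \<subseteq> carrier G" using ys S by blast
    show "z \<in> carrier G" using x ysc z by simp
    \<comment> \<open>The arbitrary first entry is replaced by a word of length at most
      \<open>D\<close> that agrees with it modulo \<open>G_2\<close>.\<close>
    have "\<forall>h\<in>carrier G. \<exists>w\<in>word_ball G S D. lc_eq 2 w h"
      using quotient_diam_le_iff[OF sym gen fin lower_central_normal subgroup_self, of 2 D]
      by (simp add: D_def)
    then obtain w where w: "w \<in> word_ball G S D" "lc_eq 2 w x"
      using x by blast
    then obtain ws where ws: "set ws \<subseteq> S" "length ws \<le> D" "w = word_prod G ws"
      by (auto elim: word_ballE)
    obtain v where v: "v \<in> word_ball G S ((length ws div m ^ Suc n + card S) * (8 ^ n * m))"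
        "lc_eq (Suc (Suc n)) v (iter_commutator G w ys)"
      using iter_commutator_word[OF sym m ys(1) finS subset_refl ws(1)] ys ws by auto
    have "length ws div m ^ Suc n \<le> D div m ^ Suc n"
      using ws(2) by (rule div_le_mono)
    then have "v \<in> word_ball G S ?B"
      using v(1) by (elim word_ball_mono) (intro mult_le_mono1 add_le_mono1)
    moreover have "lc_eq (Suc (Suc n)) v z"
      using v(2) iter_commutator_cong[OF word_ball_closed[OF S w(1)] x w(2) ysc] ys z by simp
    ultimately show "\<exists>w\<in>word_ball G S ?B. lc_eq (Suc (Suc n)) w z" by blast
  qed
  have "\<exists>w\<in>word_ball G S (length zs * ?B). lc_eq (Suc (Suc n)) w (word_prod G zs)"
    using zc ball by (intro word_ball_word_prod S) auto
  then show "\<exists>w\<in>word_ball G S (card S ^ n * ?B). lc_eq (Suc (Suc n)) w g"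
    using zs by simp
qed

text \<open>Induction downwards from the trivial term, where the sum is empty: a representative
  \<open>w\<close> of the coset of \<open>g\<close> modulo the next term is split off, leaving
  \<open>h\<close> in that term.\<close>

lemma lower_central_in_word_ball:
  assumes sym: "symmetric_subset G S" and gen: "generate G S = carrier G"
    and fin: "finite (carrier G)" and triv: "lower_central G (Suc L) = {\<one>}"
    and j: "j \<le> Suc L"
  shows "g \<in> lower_central G j \<Longrightarrow>
    g \<in> word_ball G S (\<Sum>i=j..L. quotient_diam G S (lower_central G i) (lower_central G (Suc i)))"
  using j
proof (induction j arbitrary: g rule: inc_induct)
  case base
  then show ?case using triv one_in_word_ball by simp
next
  case (step j)
  let ?q = "\<lambda>i. quotient_diam G S (lower_central G i) (lower_central G (Suc i))"
  have S: "S \<subseteq> carrier G"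
    using sym by (auto simp: symmetric_subset_def)
  obtain w where w: "w \<in> word_ball G S (?q j)" "lc_eq (Suc j) g w"
    using quotient_diam_le_iff[OF sym gen fin lower_central_normal lower_central_subgroup, of j "Suc j" "?q j"]
      step.prems by auto
  obtain h where h: "h \<in> lower_central G (Suc j)" "g = h \<otimes> w"
    using lc_eqE[OF w(2) lower_central_carrier[OF step.prems] word_ball_closed[OF S w(1)]] .
  have "h \<otimes> w \<in> word_ball G S ((\<Sum>i=Suc j..L. ?q i) + ?q j)"
    using step.IH[OF h(1)] w(1) by (rule word_ball_mult[OF S])
  then show ?case
    using step.hyps h(2) by (simp add: sum.atLeast_Suc_atMost add.commute)
qed

text \<open>Each element of \<open>S\<close> lies in \<open>R\<close> or is the inverse of an
  element of \<open>R\<close>.\<close>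

lemma card_symmetric_le:
  assumes "finite R" "S \<subseteq> carrier G"
    and "\<And>s. s \<in> S \<Longrightarrow> card ({s, inv s} \<inter> R) = 1"
  shows "card S \<le> 2 * card R"
proof -
  have "S \<subseteq> R \<union> m_inv G ` R"
  proof
    fix s
    assume s: "s \<in> S"
    then have "{s, inv s} \<inter> R \<noteq> {}"
      using assms(3) by force
    then show "s \<in> R \<union> m_inv G ` R"
      using s assms(2) by (force simp: image_iff)
  qed
  then have "card S \<le> card (R \<union> m_inv G ` R)"
    using assms(1) by (intro card_mono) auto
  also have "\<dots> \<le> card R + card (m_inv G ` R)"
    by (rule card_Un_le)
  also have "\<dots> \<le> 2 * card R"
    using card_image_le[OF assms(1), of "m_inv G"] by simp
  finally show ?thesis .
qed

end

section \<open>The numerical estimate and the theorem\<close>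

text \<open>With \<open>m\<close> just above the \<open>i\<close>-th root of the rounded-up quotient
  \<open>D / r\<close>, the part \<open>D div m ^ i\<close> is at most \<open>r\<close>, comparable
  to the term \<open>s \<le> 2 * r\<close> beside it. The bound becomes
  \<open>3 * 16 ^ (i - 1) * r ^ i * m\<close>.\<close>

lemma root_scale_bound:
  fixes D r i L d s :: nat
  assumes r: "r > 0" and i: "i \<ge> 1" and L: "L \<ge> 1" and s: "s \<le> 2 * r"
    and d: "\<And>m. m \<ge> 1 \<Longrightarrow> d \<le> s ^ (i - 1) * ((D div m ^ i + s) * (8 ^ (i - 1) * m))"
  shows "real d \<le> 2 ^ (5 * i + 7) * real r ^ i *
    (2 ^ (2 * i) + real L * real_of_int \<lceil>real D / real r\<rceil> powr (1 / real i))"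
proof -
  define q where "q = real_of_int \<lceil>real D / real r\<rceil>"
  define p where "p = q powr (1 / real i)"
  \<comment> \<open>Adding 1 to the floor gives both \<open>m \<ge> p\<close> and
    \<open>m \<ge> 1\<close>, the latter also when \<open>D = 0\<close>.\<close>
  define m where "m = nat \<lfloor>p\<rfloor> + 1"
  have q: "real D \<le> q * real r" "q \<ge> 0"
    using r by (simp_all add: q_def pos_divide_le_eq[symmetric] less_le_trans[of "-1" 0])
  have p: "p \<ge> 0" by (simp add: p_def)
  have m: "p \<le> real m" "real m \<le> p + 1" "m \<ge> 1"
    using p unfolding m_def by linarith+
  \<comment> \<open>The case \<open>q = 0\<close> is separate because \<open>powr_realpow\<close>
    requires a positive base.\<close>
  have "q = p ^ i"
    using q i by (cases "q = 0") (auto simp: p_def powr_powr powr_realpow[symmetric])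
  also have "\<dots> \<le> real m ^ i"
    using p m by (intro power_mono)
  finally have "real D \<le> real m ^ i * real r"
    using q(1) mult_right_mono[of q "real m ^ i" "real r"] by simp
  then have "real D \<le> real (r * m ^ i)"
    by (simp add: mult.commute)
  then have "D div m ^ i \<le> r"
    using m(3) by (subst (asm) of_nat_le_iff) (simp add: div_le_mono[of D "r * m ^ i" "m ^ i", THEN order_trans])
  then have "s ^ (i - 1) * ((D div m ^ i + s) * (8 ^ (i - 1) * m)) \<le>
      (2 * r) ^ (i - 1) * ((3 * r) * (8 ^ (i - 1) * m))"
    using s by (intro mult_le_mono power_mono) auto
  also have "\<dots> = 3 * 16 ^ (i - 1) * r ^ i * m"
  proof -
    have "r ^ i = r ^ (i - 1) * r"
      using i by (cases i) auto
    moreover have "(2::nat) ^ (i - 1) * 8 ^ (i - 1) = 16 ^ (i - 1)"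
      by (simp add: power_mult_distrib[symmetric])
    ultimately show ?thesis
      by (simp add: power_mult_distrib mult_ac)
  qed
  also have "3 * 16 ^ (i - 1) * r ^ i * m \<le> 2 ^ (5 * i + 7) * r ^ i * m"
  proof -
    have "3 * (16::nat) ^ (i - 1) \<le> 4 * 2 ^ (4 * (i - 1))"
      by (simp add: power_mult)
    also have "\<dots> = 2 ^ (2 + 4 * (i - 1))"
      by (simp add: power_add)
    also have "\<dots> \<le> 2 ^ (5 * i + 7)"
      by (intro power_increasing) auto
    finally show ?thesis by (intro mult_le_mono1)
  qed
  finally have "d \<le> 2 ^ (5 * i + 7) * r ^ i * m"
    using d[OF m(3)] by linarith
  then have "real d \<le> real (2 ^ (5 * i + 7) * r ^ i * m)"
    by (rule of_nat_mono)
  also have "\<dots> = 2 ^ (5 * i + 7) * real r ^ i * real m"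
    by simp
  also have "\<dots> \<le> 2 ^ (5 * i + 7) * real r ^ i * (2 ^ (2 * i) + real L * p)"
  proof (intro mult_left_mono)
    \<comment> \<open>The summand \<open>2 ^ (2 * i)\<close> absorbs the 1 in
      \<open>m \<le> p + 1\<close>, and the factor \<open>L\<close> only enlarges the root
      term.\<close>
    have "p \<le> real L * p" "(1::real) \<le> 2 ^ (2 * i)"
      using mult_right_mono[of 1 "real L" p] L p by simp_all
    then show "real m \<le> 2 ^ (2 * i) + real L * p"
      using m(2) by linarith
  qed simp
  finally show ?thesis
    unfolding p_def q_def .
qed

theorem theorem4:
  fixes G :: "('a, 'b) monoid_scheme" and L :: nat and S R :: "'a set"
  assumes nilpotent: "finite_nilpotent_of_step G L" and step: "L \<ge> 2"
    and symmetric: "symmetric_subset G S"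
    and generators: "generate G S = carrier G"
    and R_subset: "R \<subseteq> S"
    and R_choice: "\<And>s. s \<in> S \<Longrightarrow> card ({s, inv\<^bsub>G\<^esub> s} \<inter> R) = 1"
  shows "subgroup_diam G S (lower_central G 2)
           \<le> (\<Sum>i=2..L. quotient_diam G S (lower_central G i) (lower_central G (i + 1)))
       \<and> real (\<Sum>i=2..L. quotient_diam G S (lower_central G i) (lower_central G (i + 1)))
           \<le> (\<Sum>i=2..L. 2 ^ (5 * i + 7) * real (card R) ^ i *
                (2 ^ (2 * i) + real L *
                   real_of_int \<lceil>real (quotient_diam G S (carrier G) (lower_central G 2)) / real (card R)\<rceil>
                     powr (1 / real i)))"
proof -
  interpret group G
    using nilpotent by (simp add: finite_nilpotent_of_step_def)
  have fin: "finite (carrier G)" and nontrivial: "card (lower_central G L) > 1"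
    and last: "card (lower_central G (Suc L)) = 1"
    using nilpotent by (auto simp: finite_nilpotent_of_step_def)
  have S: "S \<subseteq> carrier G"
    using symmetric by (simp add: symmetric_subset_def)
  have "finite S"
    using finite_subset[OF S fin] .
  then have finR: "finite R"
    using finite_subset[OF R_subset] by blast
  have "\<one>\<^bsub>G\<^esub> \<in> lower_central G (Suc L)"
    by (rule subgroup.one_closed[OF lower_central_subgroup])
  then have triv: "lower_central G (Suc L) = {\<one>\<^bsub>G\<^esub>}"
    using last by (auto simp: card_1_singleton_iff)
  have card_S: "card S \<le> 2 * card R"
    using finR S R_choice by (rule card_symmetric_le)
  \<comment> \<open>An empty \<open>S\<close> would make \<open>G\<close> trivial, contradicting the
    size of the \<open>L\<close>-th term. Positivity of \<open>card R\<close>, by which the bound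
    divides, follows.\<close>
  have "S \<noteq> {}"
  proof
    assume "S = {}"
    then have "carrier G = {\<one>\<^bsub>G\<^esub>}"
      using generators generate_empty by simp
    then have "card (lower_central G L) \<le> card {\<one>\<^bsub>G\<^esub>}"
      using lower_central_carrier by (intro card_mono) auto
    then show False using nontrivial by simp
  qed
  then have card_R: "card R > 0"
    using card_S \<open>finite S\<close> by (cases "card R") auto
  let ?D = "quotient_diam G S (carrier G) (lower_central G 2)"
  have diam: "real (quotient_diam G S (lower_central G i) (lower_central G (i + 1))) \<le>
      2 ^ (5 * i + 7) * real (card R) ^ i *
      (2 ^ (2 * i) + real L * real_of_int \<lceil>real ?D / real (card R)\<rceil> powr (1 / real i))"
    if "i \<in> {2..L}" for i
  proof (rule root_scale_bound[OF card_R _ _ card_S])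
    \<comment> \<open>The bound for the factors is indexed by \<open>Suc n\<close>; it is used with
      \<open>n = i - 1\<close>, where \<open>i \<ge> 2\<close> makes the natural subtraction
      harmless.\<close>
    show "quotient_diam G S (lower_central G i) (lower_central G (i + 1)) \<le>
        card S ^ (i - 1) * ((?D div m ^ i + card S) * (8 ^ (i - 1) * m))" if "m \<ge> 1" for m
      using quotient_diam_lower_central_le[OF symmetric generators fin that, of "i - 1"] \<open>i \<in> {2..L}\<close>
      by (simp del: power_Suc)
  qed (use that step in auto)
  show ?thesis
  proof
    have "subgroup_diam G S (lower_central G 2) \<le>
        (\<Sum>i=2..L. quotient_diam G S (lower_central G i) (lower_central G (Suc i)))"
      using lower_central_in_word_ball[OF symmetric generators fin triv, of 2] step
      by (intro subgroup_diam_le symmetric generators fin lower_central_subgroup subsetI) auto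
    then show "subgroup_diam G S (lower_central G 2)
        \<le> (\<Sum>i=2..L. quotient_diam G S (lower_central G i) (lower_central G (i + 1)))"
      by simp
  next
    show "real (\<Sum>i=2..L. quotient_diam G S (lower_central G i) (lower_central G (i + 1)))
        \<le> (\<Sum>i=2..L. 2 ^ (5 * i + 7) * real (card R) ^ i *
          (2 ^ (2 * i) + real L * real_of_int \<lceil>real ?D / real (card R)\<rceil> powr (1 / real i)))"
      unfolding of_nat_sum by (rule sum_mono) (rule diam)
  qed
qed

end
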